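(* Let $N\ge 2$ and set $$\widetilde\beta^*:=\inf_{v\in D_{rad}(\mathbb R^N),\ v\neq0}\ \frac{\int_{\mathbb R^N}\left(|\nabla v(x)|^2-V(x)v(x)^2\right)dx}{\int_{\mathbb R^N}\frac{v(x)^2}{|x|^2}dx},$$ where $$V(x)=\left(\frac1{1+\frac18|x|^2}\right)^2\ \text{ if }N=2,\qquad V(x)=\frac{N+2}{N-2}\left(\frac{N(N-2)}{N(N-2)+|x|^2}\right)^2\ \text{ if }N\ge3 .$$ Then $\widetilde\beta^*=-(N-1)$, and the infimum is achieved at the function $$\eta_1(x)=\frac{|x|}{1+\frac18|x|^2}\ \text{ if }N=2,\qquad \eta_1(x)=\frac{|x|}{\left(1+\frac{|x|^2}{N(N-2)}\right)^{N/2}}\ \text{ if }N\ge3 .$$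
   Context: $D^{1,2}(\mathbb R^N)$ is the closure of $C_c^\infty(\mathbb R^N)$ with respect to the norm $\left(\int_{\mathbb R^N}|\nabla v|^2dx\right)^{1/2}$, $D^{1,2}_{rad}(\mathbb R^N)$ is its subspace of radial functions, and $L^2_{1/|x|}(\mathbb R^N)=\{v:\mathbb R^N\to\mathbb R:\ v/|x|\in L^2(\mathbb R^N)\}$. Define $D_{rad}(\mathbb R^N)=D^{1,2}_{rad}(\mathbb R^N)\cap L^2_{1/|x|}(\mathbb R^N)$, with scalar product $\int\nabla u\cdot\nabla v\,dx+\int\frac{uv}{|x|^2}dx$. (Concretely, $D_{rad}(\mathbb R^N)$ consists of the radial functions $v$ with weak gradient in $L^2(\mathbb R^N)$ and $v/|x|\in L^2(\mathbb R^N)$.) *)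

theory Defs
  imports "HOL-Analysis.Analysis"
begin

primrec continuously_differentiable :: "nat \<Rightarrow> ('a::euclidean_space \<Rightarrow> real) \<Rightarrow> bool" where
  "continuously_differentiable 0 f \<longleftrightarrow> continuous_on UNIV f"
| "continuously_differentiable (Suc k) f \<longleftrightarrow>
     (\<forall>x. f differentiable (at x)) \<and>
     (\<forall>b\<in>Basis. continuously_differentiable k (\<lambda>x. frechet_derivative f (at x) b))"

definition test_function :: "('a::euclidean_space \<Rightarrow> real) \<Rightarrow> bool" where
  "test_function \<phi> \<longleftrightarrow>
     (\<forall>k. continuously_differentiable k \<phi>) \<and> compact (closure {x. \<phi> x \<noteq> 0})"

definition gradient :: "('a::euclidean_space \<Rightarrow> real) \<Rightarrow> 'a \<Rightarrow> 'a" where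
  "gradient f x = (\<Sum>b\<in>Basis. frechet_derivative f (at x) b *\<^sub>R b)"

definition locally_integrable ::
    "('a::euclidean_space \<Rightarrow> 'b::{banach, second_countable_topology}) \<Rightarrow> bool" where
  "locally_integrable f \<longleftrightarrow> (\<forall>K. compact K \<longrightarrow> set_integrable lebesgue K f)"

definition square_integrable ::
    "('a::euclidean_space \<Rightarrow> 'b::{banach, second_countable_topology}) \<Rightarrow> bool" where
  "square_integrable f \<longleftrightarrow>
     f \<in> borel_measurable lebesgue \<and> integrable lebesgue (\<lambda>x. (norm (f x))\<^sup>2)"

definition has_weak_gradient :: "('a::euclidean_space \<Rightarrow> real) \<Rightarrow> ('a \<Rightarrow> 'a) \<Rightarrow> bool" where
  "has_weak_gradient v G \<longleftrightarrow>
     locally_integrable v \<and> locally_integrable G \<and>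
     (\<forall>\<phi>. test_function \<phi> \<longrightarrow>
        (\<forall>b\<in>Basis. (LINT x|lebesgue. v x * (gradient \<phi> x \<bullet> b)) =
                  - (LINT x|lebesgue. \<phi> x * (G x \<bullet> b))))"

(* The choice is harmless: two weak gradients of the same function agree almost everywhere. *)
definition weak_gradient :: "('a::euclidean_space \<Rightarrow> real) \<Rightarrow> 'a \<Rightarrow> 'a" where
  "weak_gradient v = (SOME G. has_weak_gradient v G)"

(* The closure of the test functions in the norm of the gradient in L^2, realised as a space of
   functions: the approximating sequence converges to v in L^1_loc as well.  In dimension at
   least 3 the Sobolev inequality makes local convergence automatic for the limit of a Cauchy
   sequence, and it rules out the nonzero constants.  In dimension 2 an element of the abstract
   completion determines a function only up to an additive constant, and the set below contains
   all of these representatives; at most one of them, up to null sets, lies in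
   L2_inverse_norm. *)
definition D12 :: "('a::euclidean_space \<Rightarrow> real) set" where
  "D12 = {v. (\<exists>G. has_weak_gradient v G) \<and> square_integrable (weak_gradient v) \<and>
     (\<exists>\<phi>. (\<forall>n::nat. test_function (\<phi> n)) \<and>
        (\<forall>K. compact K \<longrightarrow> (\<lambda>n. LINT x:K|lebesgue. \<bar>\<phi> n x - v x\<bar>) \<longlonglongrightarrow> 0) \<and>
        (\<lambda>n. LINT x|lebesgue. (norm (gradient (\<phi> n) x - weak_gradient v x))\<^sup>2) \<longlonglongrightarrow> 0)}"

(* Members of the function spaces stand for their classes modulo null sets, so radial symmetry
   is required almost everywhere only. *)
definition D12_rad :: "('a::euclidean_space \<Rightarrow> real) set" where
  "D12_rad = {v \<in> D12. \<exists>f. AE x in lebesgue. v x = f (norm x)}"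

definition L2_inverse_norm :: "('a::euclidean_space \<Rightarrow> real) set" where
  "L2_inverse_norm = {v. square_integrable (\<lambda>x. v x / norm x)}"

definition D_rad :: "('a::euclidean_space \<Rightarrow> real) set" where
  "D_rad = D12_rad \<inter> L2_inverse_norm"

definition potential :: "'a::euclidean_space \<Rightarrow> real" where
  "potential x =
     (let N = real DIM('a) in
      if DIM('a) = 2 then (1 / (1 + (norm x)\<^sup>2 / 8))\<^sup>2
      else (N + 2) / (N - 2) * (N * (N - 2) / (N * (N - 2) + (norm x)\<^sup>2))\<^sup>2)"

definition eta1 :: "'a::euclidean_space \<Rightarrow> real" where
  "eta1 x =
     (let N = real DIM('a) in
      if DIM('a) = 2 then norm x / (1 + (norm x)\<^sup>2 / 8)
      else norm x / (1 + (norm x)\<^sup>2 / (N * (N - 2))) powr (N / 2))"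

definition rayleigh_quotient :: "('a::euclidean_space \<Rightarrow> real) \<Rightarrow> real" where
  "rayleigh_quotient v =
     (LINT x|lebesgue. (norm (weak_gradient v x))\<^sup>2 - potential x * (v x)\<^sup>2) /
     (LINT x|lebesgue. (v x)\<^sup>2 / (norm x)\<^sup>2)"

definition admissible :: "('a::euclidean_space \<Rightarrow> real) set" where
  "admissible = {v \<in> D_rad. \<not> (AE x in lebesgue. v x = 0)}"

(* Taken in the extended reals, so that its being finite is part of any claim about its value. *)
definition beta_star :: "'a::euclidean_space itself \<Rightarrow> ereal" where
  "beta_star _ = (INF v \<in> (admissible :: ('a \<Rightarrow> real) set). ereal (rayleigh_quotient v))"

end

theory Submission
  imports Defs "HOL-Probability.Sinc_Integral"
begin

text \<open>
Write \<open>N\<close> for the dimension, \<open>r = |x|\<close>, and \<open>a = 8\<close> if \<open>N = 2\<close>, \<open>a = N (N - 2)\<close> otherwise. In terms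
of \<open>a\<close> both dimension ranges are described by the same formulas:
\<open>\<eta> = r (1 + r\<^sup>2/a) powr (- N/2)\<close> and \<open>V = N (N + 2) a / (a + r\<^sup>2)\<^sup>2\<close> (\<open>eta1_eq\<close>, \<open>potential_eq\<close>).
Away from the origin \<open>\<nabla>\<eta> = \<eta> F\<close> with the radial field \<open>F = q x\<close>, \<open>q = 1/r\<^sup>2 - N/(a + r\<^sup>2)\<close>, and
\<open>div F + |F|\<^sup>2 = (N - 1)/r\<^sup>2 - V\<close>: this says that \<open>\<eta>\<close> solves the Euler equation with
eigenvalue \<open>-(N - 1)\<close>.

The lower bound is Picone's argument. For every test function,
\<open>0 \<le> \<integral> |\<nabla>\<psi> - \<psi> F|\<^sup>2 = \<integral> |\<nabla>\<psi>|\<^sup>2 + \<integral> \<psi>\<^sup>2 (div F + |F|\<^sup>2)\<close>, because \<open>\<psi>\<^sup>2 F\<close> has a divergence of integral zero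
(\<open>picone_inequality\<close>). Two things stand between this and a member \<open>v\<close> of the space. The field \<open>F\<close> is
singular at the origin and its divergence is not compactly supported; it is therefore replaced by
regularised and truncated fields for which \<open>r\<^sup>2 |div F + |F|\<^sup>2|\<close> stays bounded
(\<open>profile_weight_bound\<close>), so that \<open>v\<^sup>2/r\<^sup>2\<close> is an integrable majorant. Moreover the approximating test
functions converge to \<open>v\<close> in \<open>L\<^sup>1\<close> locally only, which does not control \<open>\<integral> \<psi>\<^sup>2 (div F + |F|\<^sup>2)\<close>. They
are composed with \<open>s \<mapsto> k sin (s/k)\<close>, which does not increase gradients and has a Lipschitz continuous
square. First the test functions tend to \<open>v\<close> (\<open>picone_inequality_truncated_limit\<close>), and then all
regularisations are removed at once by dominated convergence (\<open>hardy_type_inequality\<close>).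

For the function \<open>\<eta>\<close> the square in Picone's argument vanishes identically, and
\<open>\<integral> div (\<eta>\<^sup>2 F) = 0\<close> turns this into the value \<open>-(N - 1)\<close> of the quotient (\<open>eta_energy\<close>). That \<open>\<eta>\<close> belongs
to the space is shown with the test functions
\<open>\<chi>(r\<^sup>2/n) sqrt (r\<^sup>2 + 1/n) (1 + r\<^sup>2/a) powr (- N/2)\<close>, where \<open>\<chi>\<close> is a cutoff: their gradients are bounded by a
multiple of \<open>(1 + r\<^sup>2/a) powr (- N/2)\<close>, whose square is integrable, and converge pointwise. As the weak
gradient is chosen arbitrarily among all possible ones, its uniqueness up to null sets is needed
to identify it with the pointwise gradient (\<open>weak_gradient_unique_AE\<close>).
\<close>

section \<open>Continuously differentiable functions\<close>

lemma continuously_differentiable_imp_continuous_on: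
  "continuously_differentiable k f \<Longrightarrow> continuous_on UNIV f"
  by (cases k)
    (auto simp: continuous_on_eq_continuous_at intro: differentiable_imp_continuous_within)

lemma continuously_differentiable_Suc_imp:
  "continuously_differentiable (Suc k) f \<Longrightarrow> continuously_differentiable k f"
proof (induction k arbitrary: f)
  case 0
  then show ?case
    using continuously_differentiable_imp_continuous_on by fastforce
next
  case (Suc k)
  then show ?case by simp
qed

lemma continuously_differentiable_SucI:
  fixes f :: "'a::euclidean_space \<Rightarrow> real"
  assumes "\<And>x. (f has_derivative f' x) (at x)"
    and "\<And>b. b \<in> Basis \<Longrightarrow> continuously_differentiable k (\<lambda>x. f' x b)"
  shows "continuously_differentiable (Suc k) f"
proof -
  have "frechet_derivative f (at x) = f' x" for x
    using frechet_derivative_at[OF assms(1)] by simp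
  then show ?thesis
    using assms by (auto simp: differentiable_def)
qed

lemma continuously_differentiable_has_derivative:
  "continuously_differentiable (Suc k) f \<Longrightarrow>
    (f has_derivative frechet_derivative f (at x)) (at x)"
  by (simp add: frechet_derivative_works[symmetric])

lemma continuously_differentiable_partial:
  "continuously_differentiable (Suc k) f \<Longrightarrow> b \<in> Basis \<Longrightarrow>
    continuously_differentiable k (\<lambda>x. frechet_derivative f (at x) b)"
  by simp

lemma continuously_differentiable_const [intro]: "continuously_differentiable k (\<lambda>x. c)"
proof (induction k arbitrary: c)
  case (Suc k)
  show ?case
    by (rule continuously_differentiable_SucI[where f' = "\<lambda>_ _. 0"]) (auto intro: Suc)
qed simp

lemma continuously_differentiable_add [intro]:
  "continuously_differentiable k f \<Longrightarrow> continuously_differentiable k g \<Longrightarrow>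
    continuously_differentiable k (\<lambda>x. f x + g x)"
proof (induction k arbitrary: f g)
  case 0
  then show ?case by (auto intro: continuous_intros)
next
  case (Suc k)
  note d = Suc.prems[THEN continuously_differentiable_has_derivative]
  show ?case
    by (rule continuously_differentiable_SucI[OF has_derivative_add[OF d]])
      (rule Suc.IH[OF Suc.prems[THEN continuously_differentiable_partial]])
qed

lemma continuously_differentiable_mult [intro]:
  "continuously_differentiable k f \<Longrightarrow> continuously_differentiable k g \<Longrightarrow>
    continuously_differentiable k (\<lambda>x. f x * g x)"
proof (induction k arbitrary: f g)
  case 0
  then show ?case by (simp add: continuous_on_mult)
next
  case (Suc k)
  note d = Suc.prems[THEN continuously_differentiable_has_derivative]
  note c = Suc.prems[THEN continuously_differentiable_Suc_imp]
  show ?case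
  proof (rule continuously_differentiable_SucI[OF has_derivative_mult[OF d]])
    fix b :: 'a assume b: "b \<in> Basis"
    note p = Suc.prems[THEN continuously_differentiable_partial, OF b]
    show "continuously_differentiable k
        (\<lambda>x. f x * frechet_derivative g (at x) b + frechet_derivative f (at x) b * g x)"
      by (rule continuously_differentiable_add[OF Suc.IH[OF c(1) p(2)] Suc.IH[OF p(1) c(2)]])
  qed
qed

lemma continuously_differentiable_diff [intro]:
  assumes "continuously_differentiable k f" "continuously_differentiable k g"
  shows "continuously_differentiable k (\<lambda>x. f x - g x)"
  using continuously_differentiable_add[OF assms(1)
      continuously_differentiable_mult[OF continuously_differentiable_const[of k "-1"] assms(2)]]
  by simp

lemma continuously_differentiable_prod [intro]:
  "(\<And>i. i \<in> I \<Longrightarrow> continuously_differentiable k (f i)) \<Longrightarrow>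
    continuously_differentiable k (\<lambda>x. \<Prod>i\<in>I. f i x)"
  by (induction I rule: infinite_finite_induct) auto

lemma continuously_differentiable_sum [intro]:
  "(\<And>i. i \<in> I \<Longrightarrow> continuously_differentiable k (f i)) \<Longrightarrow>
    continuously_differentiable k (\<lambda>x. \<Sum>i\<in>I. f i x)"
  by (induction I rule: infinite_finite_induct) auto

lemma continuously_differentiable_inner [intro]: "continuously_differentiable k (\<lambda>x. x \<bullet> c)"
proof (cases k)
  case 0
  then show ?thesis by (auto intro!: continuous_intros)
next
  case (Suc k)
  show ?thesis unfolding Suc
    by (rule continuously_differentiable_SucI[where f' = "\<lambda>_ y. y \<bullet> c"])
      (auto intro!: derivative_eq_intros)
qed

lemma continuously_differentiable_norm_square [intro]:
  "continuously_differentiable k (\<lambda>x::'a::euclidean_space. (norm x)\<^sup>2)"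
proof -
  have "continuously_differentiable k (\<lambda>x::'a. \<Sum>b\<in>Basis. (x \<bullet> b) * (x \<bullet> b))"
    by (intro continuously_differentiable_sum continuously_differentiable_mult
        continuously_differentiable_inner)
  also have "(\<lambda>x::'a. \<Sum>b\<in>Basis. (x \<bullet> b) * (x \<bullet> b)) = (\<lambda>x. (norm x)\<^sup>2)"
    by (simp add: power2_norm_eq_inner euclidean_inner[symmetric])
  finally show ?thesis .
qed

text \<open>The inner derivative is handled by the product rule; the outer functions are taken from a family
\<open>P\<close> closed under differentiation, so that the induction on the order can be done for all members of the
family simultaneously.\<close>
lemma continuously_differentiable_compose:
  fixes u :: "'a::euclidean_space \<Rightarrow> real"
  assumes closed: "\<And>g. P g \<Longrightarrow> \<exists>g'. P g' \<and> (\<forall>s\<in>S. (g has_real_derivative g' s) (at s))"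
    and g: "P g" and u: "continuously_differentiable k u" and S: "range u \<subseteq> S"
  shows "continuously_differentiable k (\<lambda>x. g (u x))"
  using g u
proof (induction k arbitrary: g)
  case 0
  from closed[OF 0(1)] obtain g' where g': "\<forall>s\<in>S. (g has_real_derivative g' s) (at s)"
    by blast
  have "isCont (\<lambda>x. g (u x)) x" for x
    using 0(2) g' S by (intro isCont_o2[of _ u g])
      (auto simp: continuous_on_eq_continuous_at image_subset_iff intro: DERIV_isCont)
  then show ?case
    by (simp add: continuous_on_eq_continuous_at)
next
  case (Suc k)
  from closed[OF Suc(2)] obtain g' where g': "P g'" "\<forall>s\<in>S. (g has_real_derivative g' s) (at s)"
    by blast
  note u' = continuously_differentiable_has_derivative[OF Suc(3)]
  have "((\<lambda>x. g (u x)) has_derivative (\<lambda>y. frechet_derivative u (at x) y * g' (u x))) (at x)" for x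
    using S g'(2) by (intro DERIV_compose_FDERIV[OF _ u']) auto
  then show ?case
    by (rule continuously_differentiable_SucI)
      (rule continuously_differentiable_mult[OF continuously_differentiable_partial[OF Suc.prems(2)]
          Suc.IH[OF g'(1) continuously_differentiable_Suc_imp[OF Suc.prems(2)]]])
qed

lemma continuously_differentiable_powr [intro]:
  assumes "continuously_differentiable k u" "\<And>x. u x > 0"
  shows "continuously_differentiable k (\<lambda>x. u x powr p)"
proof -
  let ?P = "\<lambda>g. \<exists>c p. g = (\<lambda>s::real. c * s powr p)"
  have "\<exists>g'. ?P g' \<and> (\<forall>s\<in>{0<..}. (g has_real_derivative g' s) (at s))" if "?P g" for g
  proof -
    from that obtain c p where g: "g = (\<lambda>s::real. c * s powr p)"
      by blast
    have "(g has_real_derivative (c * p) * s powr (p - 1)) (at s)" if "s \<in> {0<..}" for s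
      unfolding g using that by (auto intro!: derivative_eq_intros)
    then show ?thesis
      by (intro exI[of _ "\<lambda>s. (c * p) * s powr (p - 1)"]) blast
  qed
  moreover have "?P (\<lambda>s. s powr p)"
    by (intro exI[of _ 1] exI[of _ p]) simp
  ultimately show ?thesis
    using assms(1)
    by (rule continuously_differentiable_compose[where P = ?P and S = "{0<..}" and u = u
          and g = "\<lambda>s. s powr p"])
      (use assms(2) in auto)
qed

lemma continuously_differentiable_inverse [intro]:
  assumes "continuously_differentiable k u" "\<And>x. u x > 0"
  shows "continuously_differentiable k (\<lambda>x. 1 / u x)"
proof -
  have "(\<lambda>x. 1 / u x) = (\<lambda>x. u x powr (-1))"
    using assms(2) by (auto simp: powr_minus_divide less_imp_le)
  then show ?thesis
    using continuously_differentiable_powr[OF assms, of "-1"] by metis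
qed

lemma continuously_differentiable_sin [intro]:
  assumes "continuously_differentiable k u"
  shows "continuously_differentiable k (\<lambda>x. sin (u x))"
proof -
  let ?P = "\<lambda>g. \<exists>c d. g = (\<lambda>s::real. c * sin s + d * cos s)"
  have "\<exists>g'. ?P g' \<and> (\<forall>s\<in>UNIV. (g has_real_derivative g' s) (at s))" if "?P g" for g
  proof -
    from that obtain c d where g: "g = (\<lambda>s::real. c * sin s + d * cos s)"
      by blast
    have "(g has_real_derivative ((-d) * sin s + c * cos s)) (at s)" for s
      unfolding g by (auto intro!: derivative_eq_intros)
    then show ?thesis
      by (intro exI[of _ "\<lambda>s. (-d) * sin s + c * cos s"]) blast
  qed
  moreover have "?P sin"
    by (intro exI[of _ 1] exI[of _ 0]) simp
  ultimately show ?thesis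
    using assms
    by (rule continuously_differentiable_compose[where P = ?P and S = UNIV and g = sin]) auto
qed

section \<open>A smooth function vanishing on a half-line\<close>

text \<open>The functions \<open>p(1/t) exp(-1/t)\<close>, extended by zero to \<open>t \<le> 0\<close>, with \<open>p\<close> a polynomial, form a family
that is closed under differentiation and contains the classical function \<open>exp(-1/t)\<close>, for \<open>p = 1\<close>.\<close>
definition flat_poly :: "real poly \<Rightarrow> real \<Rightarrow> real" where
  "flat_poly p t = (if t > 0 then poly p (1 / t) * exp (- (1 / t)) else 0)"

lemma poly_times_exp_minus_tendsto_0: "((\<lambda>s::real. poly p s * exp (- s)) \<longlongrightarrow> 0) at_top"
proof -
  have "((\<lambda>s. \<Sum>i\<le>degree p. coeff p i * (s ^ i / exp s)) \<longlongrightarrow> (\<Sum>i\<le>degree p. coeff p i * 0)) at_top"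
    by (intro tendsto_intros tendsto_power_div_exp_0)
  also have "(\<lambda>s. \<Sum>i\<le>degree p. coeff p i * (s ^ i / exp s)) = (\<lambda>s. poly p s * exp (- s))"
    by (auto simp: poly_altdef sum_distrib_right exp_minus divide_inverse mult.assoc)
  finally show ?thesis by simp
qed

text \<open>For \<open>t > 0\<close> the substitution \<open>s = 1/t\<close> has derivative \<open>- s\<^sup>2\<close>, which gives the polynomial
\<open>s\<^sup>2 (p - p')\<close>. At the origin the difference quotient is \<open>s p(s) exp(-s)\<close> with \<open>s \<rightarrow> \<infinity>\<close>.\<close>
lemma flat_poly_has_real_derivative:
  "(flat_poly p has_real_derivative flat_poly ([:0, 0, 1:] * (p - pderiv p)) t) (at t)"
proof -
  consider "t > 0" | "t < 0" | "t = 0" by linarith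
  then show ?thesis
  proof cases
    case 1
    have "((\<lambda>t. poly p (1 / t) * exp (- (1 / t))) has_real_derivative
        flat_poly ([:0, 0, 1:] * (p - pderiv p)) t) (at t)"
      using 1 by (auto intro!: derivative_eq_intros DERIV_chain2[OF poly_DERIV]
          simp: flat_poly_def field_simps power2_eq_square)
    then show ?thesis
      by (rule DERIV_cong_ev[THEN iffD1, OF refl _ refl, rotated])
        (rule eventually_mono[OF eventually_nhds_in_open[of "{0<..}"]],
          use 1 in \<open>auto simp: flat_poly_def\<close>)
  next
    case 2
    have "((\<lambda>t. 0) has_real_derivative flat_poly ([:0, 0, 1:] * (p - pderiv p)) t) (at t)"
      using 2 by (simp add: flat_poly_def)
    then show ?thesis
      by (rule DERIV_cong_ev[THEN iffD1, OF refl _ refl, rotated])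
        (rule eventually_mono[OF eventually_nhds_in_open[of "{..<0}"]],
          use 2 in \<open>auto simp: flat_poly_def\<close>)
  next
    case 3
    have r: "((\<lambda>h. flat_poly p h / h) \<longlongrightarrow> 0) (at_right 0)"
    proof -
      have "((\<lambda>h. poly ([:0, 1:] * p) (inverse h) * exp (- inverse h)) \<longlongrightarrow> 0) (at_right (0::real))"
        by (rule filterlim_compose[OF poly_times_exp_minus_tendsto_0 filterlim_inverse_at_top_right])
      then show ?thesis
        by (rule Lim_transform_eventually)
          (auto simp: eventually_at_right_field flat_poly_def divide_simps intro!: exI[of _ 1])
    qed
    have l: "((\<lambda>h. flat_poly p h / h) \<longlongrightarrow> 0) (at_left 0)"
      by (rule Lim_transform_eventually[OF tendsto_const])
        (auto simp: eventually_at_left_field flat_poly_def intro!: exI[of _ "-1"])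
    have "((\<lambda>h. flat_poly p h / h) \<longlongrightarrow> 0) (at 0)"
      using l r by (rule filterlim_split_at)
    then show ?thesis
      unfolding 3 DERIV_def by (simp add: flat_poly_def)
  qed
qed

lemma continuously_differentiable_flat_poly [intro]:
  assumes "continuously_differentiable k u"
  shows "continuously_differentiable k (\<lambda>x. flat_poly p (u x))"
proof (rule continuously_differentiable_compose[where P = "\<lambda>g. g \<in> range flat_poly" and S = UNIV
      and u = u and g = "flat_poly p"])
  fix g assume "g \<in> range flat_poly"
  then obtain p where "g = flat_poly p"
    by auto
  then show "\<exists>g'. g' \<in> range flat_poly \<and> (\<forall>s\<in>UNIV. (g has_real_derivative g' s) (at s))"
    using flat_poly_has_real_derivative by (intro exI conjI rangeI) auto
qed (use assms in auto)

section \<open>Gradients and integration by parts\<close>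

lemma gradient_inner_Basis: "b \<in> Basis \<Longrightarrow> gradient f x \<bullet> b = frechet_derivative f (at x) b"
  by (simp add: gradient_def inner_sum_left inner_Basis if_distrib cong: if_cong)

lemma gradient_inner:
  assumes "(f has_derivative f') (at x)"
  shows "gradient f x \<bullet> y = f' y"
proof -
  interpret linear f' using assms by (rule has_derivative_linear)
  have "gradient f x \<bullet> y = (\<Sum>b\<in>Basis. (y \<bullet> b) * f' b)"
    by (simp add: gradient_def frechet_derivative_at[OF assms, symmetric] inner_sum_left
        inner_commute[of y] mult.commute)
  also have "\<dots> = f' (\<Sum>b\<in>Basis. (y \<bullet> b) *\<^sub>R b)"
    by (simp add: sum scaleR)
  finally show ?thesis by (simp add: euclidean_representation)
qed

lemma gradient_eqI:
  assumes "(f has_derivative (\<lambda>y. g \<bullet> y)) (at x)"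
  shows "gradient f x = g"
  by (rule euclidean_eqI) (simp add: gradient_inner[OF assms])

lemma continuous_on_gradient:
  assumes "continuously_differentiable (Suc 0) f"
  shows "continuous_on UNIV (gradient f)"
  using assms unfolding gradient_def
  by (intro continuous_intros) auto

lemma test_function_iff:
  "test_function \<phi> \<longleftrightarrow>
    (\<forall>k. continuously_differentiable k \<phi>) \<and> (\<exists>R. \<forall>x. R < norm x \<longrightarrow> \<phi> x = 0)"
proof -
  have "compact (closure {x. \<phi> x \<noteq> 0}) \<longleftrightarrow> (\<exists>R. \<forall>x. R < norm x \<longrightarrow> \<phi> x = 0)"
    by (simp add: bounded_iff compact_closure) (meson not_le)
  then show ?thesis
    by (simp add: test_function_def)
qed

lemma gradient_eq_0_outside:
  assumes "\<forall>x. R < norm x \<longrightarrow> f x = 0" "R < norm x"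
  shows "gradient f x = 0"
proof (rule gradient_eqI)
  have "open {y. R < norm y}"
    by (intro open_Collect_less continuous_intros)
  then have "(f has_derivative (\<lambda>y. 0)) (at x)"
    using assms
    by (intro has_derivative_transform_within_open[OF has_derivative_const[of 0], of "{y. R < norm y}"]) auto
  then show "(f has_derivative (\<lambda>y. 0 \<bullet> y)) (at x)"
    by simp
qed

lemma integrable_continuous_bounded_support:
  fixes f :: "'a::euclidean_space \<Rightarrow> 'b::{banach, second_countable_topology}"
  assumes "continuous_on UNIV f" "\<forall>x. R < norm x \<longrightarrow> f x = 0"
  shows "integrable lebesgue f"
proof -
  have "integrable lborel (\<lambda>x. indicator (cball 0 R) x *\<^sub>R f x)"
    by (rule borel_integrable_compact[OF compact_cball continuous_on_subset[OF assms(1)]]) simp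
  also have "(\<lambda>x. indicator (cball 0 R) x *\<^sub>R f x) = f"
    using assms(2) by (auto simp: fun_eq_iff indicator_def)
  finally show ?thesis
    by (rule integrable_completion[THEN iffD2, rotated])
      (use assms(1) in \<open>simp add: borel_measurable_continuous_onI\<close>)
qed

lemma borel_measurable_lebesgue_continuous:
  "continuous_on UNIV f \<Longrightarrow> f \<in> borel_measurable lebesgue"
  by (intro measurable_completion) (simp add: borel_measurable_continuous_onI)

text \<open>By translation invariance the difference quotients of \<open>h\<close> in the direction \<open>b\<close> have integral zero. The
mean value theorem bounds them by the maximum of the partial derivative on a slightly larger ball, so
dominated convergence applies.\<close>
lemma integral_partial_derivative_eq_0:
  fixes h :: "'a::euclidean_space \<Rightarrow> real"
  assumes h: "continuously_differentiable (Suc 0) h" and R: "\<forall>x. R < norm x \<longrightarrow> h x = 0"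
    and b: "b \<in> Basis"
  shows "integrable lebesgue (\<lambda>x. frechet_derivative h (at x) b)"
    and "(LINT x|lebesgue. frechet_derivative h (at x) b) = 0"
proof -
  define h' where "h' x = frechet_derivative h (at x) b" for x
  have h'_eq: "h' x = gradient h x \<bullet> b" for x
    using b by (simp add: h'_def gradient_inner_Basis)
  have cont: "continuous_on UNIV h" "continuous_on UNIV h'"
    using h b continuously_differentiable_imp_continuous_on[OF h] by (auto simp: h'_def)
  have supp: "\<forall>x. R < norm x \<longrightarrow> h' x = 0"
    using gradient_eq_0_outside[OF R] by (simp add: h'_eq)
  show "integrable lebesgue (\<lambda>x. frechet_derivative h (at x) b)"
    using integrable_continuous_bounded_support[OF cont(2) supp] by (simp add: h'_def)
  have "bounded (h' ` cball 0 R)"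
    by (intro compact_imp_bounded compact_continuous_image compact_cball
        continuous_on_subset[OF cont(2)]) simp
  then obtain C where C: "C > 0" "\<And>x. x \<in> cball 0 R \<Longrightarrow> norm (h' x) \<le> C"
    by (auto simp: bounded_pos)
  have bnd: "\<bar>h' x\<bar> \<le> C" for x
    using C supp by (cases "norm x \<le> R") auto
  have line: "((\<lambda>t. h (x + t *\<^sub>R b)) has_real_derivative h' (x + t *\<^sub>R b)) (at t)" for x t
  proof -
    have "(h has_derivative frechet_derivative h (at (x + t *\<^sub>R b))) (at (x + t *\<^sub>R b))"
      using h by (rule continuously_differentiable_has_derivative)
    moreover have "((\<lambda>t. x + t *\<^sub>R b) has_derivative (\<lambda>s. s *\<^sub>R b)) (at t)"
      by (auto intro!: derivative_eq_intros)
    ultimately have "((\<lambda>t. h (x + t *\<^sub>R b)) has_derivative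
        (\<lambda>s. frechet_derivative h (at (x + t *\<^sub>R b)) (s *\<^sub>R b))) (at t)"
      using has_derivative_compose by blast
    moreover have "frechet_derivative h (at (x + t *\<^sub>R b)) (s *\<^sub>R b) = s * h' (x + t *\<^sub>R b)" for s
      using linear_scale[OF has_derivative_linear[OF continuously_differentiable_has_derivative[OF h]]]
      by (simp add: h'_def)
    ultimately show ?thesis
      by (simp add: has_field_derivative_def mult.commute[of _ "h' _"])
  qed
  define \<epsilon> where "\<epsilon> n = inverse (real (Suc n))" for n
  have \<epsilon>: "0 < \<epsilon> n" "\<epsilon> n \<le> 1" "\<epsilon> \<longlonglongrightarrow> 0" for n
    using LIMSEQ_inverse_real_of_nat unfolding \<epsilon>_def by (auto simp: field_simps)
  define s where "s n x = (h (x + \<epsilon> n *\<^sub>R b) - h x) / \<epsilon> n" for n x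
  have cont_shift: "continuous_on UNIV (\<lambda>x. h (x + c))" for c
    by (intro continuous_on_compose2[OF cont(1)] continuous_intros) auto
  have cont_s: "continuous_on UNIV (s n)" for n
    unfolding s_def using \<epsilon>(1)[of n] by (intro continuous_intros cont_shift cont(1)) auto
  have int_h: "integrable lborel h"
    using integrable_continuous_bounded_support[OF cont(1) R] cont(1)
    by (simp add: integrable_completion borel_measurable_continuous_onI)
  have h_borel[measurable]: "h \<in> borel_measurable borel"
    using cont(1) by (rule borel_measurable_continuous_onI)
  have int0: "(LINT x|lborel. s n x) = 0" for n
  proof -
    have "integrable (distr lborel borel ((+) (\<epsilon> n *\<^sub>R b))) h"
      by (simp add: lborel_distr_plus int_h)
    then have i: "integrable lborel (\<lambda>x. h (\<epsilon> n *\<^sub>R b + x))"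
      by (subst (asm) integrable_distr_eq) auto
    have "(LINT x|lborel. h x) = (LINT x|distr lborel borel ((+) (\<epsilon> n *\<^sub>R b)). h x)"
      by (simp add: lborel_distr_plus)
    also have "\<dots> = (LINT x|lborel. h (\<epsilon> n *\<^sub>R b + x))"
      by (subst integral_distr) auto
    finally show ?thesis
      using i int_h by (simp add: s_def add.commute)
  qed
  have lim: "(\<lambda>n. s n x) \<longlonglongrightarrow> h' x" for x
  proof -
    have "((\<lambda>t. (h (x + (0 + t) *\<^sub>R b) - h (x + 0 *\<^sub>R b)) / t) \<longlongrightarrow> h' (x + 0 *\<^sub>R b)) (at 0)"
      using line[of x 0] unfolding DERIV_def by simp
    moreover have "filterlim \<epsilon> (at 0) sequentially"
      using \<epsilon>(3) less_imp_neq[OF \<epsilon>(1)] by (auto simp: filterlim_at eventually_sequentially)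
    ultimately show ?thesis
      using filterlim_compose by (fastforce simp: s_def)
  qed
  have bound: "norm (s n x) \<le> C * indicator (cball 0 (R + 1)) x" for n x
  proof (cases "norm x \<le> R + 1")
    case True
    obtain z where "0 < z" "z < \<epsilon> n" and
      "h (x + \<epsilon> n *\<^sub>R b) - h (x + 0 *\<^sub>R b) = (\<epsilon> n - 0) * h' (x + z *\<^sub>R b)"
      using MVT2[OF \<epsilon>(1), of n "\<lambda>t. h (x + t *\<^sub>R b)" "\<lambda>t. h' (x + t *\<^sub>R b)"] line by blast
    then have "s n x = h' (x + z *\<^sub>R b)"
      using \<epsilon>(1)[of n] by (simp add: s_def)
    then show ?thesis
      using bnd True by (simp add: indicator_def)
  next
    case False
    have "norm x \<le> norm (x + \<epsilon> n *\<^sub>R b) + norm (\<epsilon> n *\<^sub>R b)"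
      by (metis add_diff_cancel_right' norm_triangle_ineq4)
    then have "R < norm (x + \<epsilon> n *\<^sub>R b)"
      using False \<epsilon>(1,2)[of n] b by (simp add: less_imp_le)
    then have "s n x = 0"
      using R False by (simp add: s_def)
    then show ?thesis
      using C by simp
  qed
  have "(\<lambda>n. LINT x|lborel. s n x) \<longlonglongrightarrow> (LINT x|lborel. h' x)"
  proof (rule integral_dominated_convergence)
    show "integrable lborel (\<lambda>x. C * indicator (cball 0 (R + 1)) x)"
      using emeasure_lborel_cball_finite
      by (intro integrable_mult_right) (simp add: integrable_indicator_iff)
    show "h' \<in> borel_measurable lborel" "s n \<in> borel_measurable lborel" for n
      using cont(2) cont_s by (auto simp: borel_measurable_continuous_onI)
  qed (use lim bound in auto)
  then have "(LINT x|lborel. h' x) = 0"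
    using int0 LIMSEQ_unique[OF _ tendsto_const] by simp
  then show "(LINT x|lebesgue. frechet_derivative h (at x) b) = 0"
    using cont(2) by (simp add: integral_completion borel_measurable_continuous_onI flip: h'_def)
qed

text \<open>The integrand is the divergence of the field \<open>p(x) x\<close>. All vector fields of this development are of this
form, which allows treating them through a scalar function.\<close>
lemma integral_divergence_radial_field_eq_0:
  fixes p :: "'a::euclidean_space \<Rightarrow> real"
  assumes p: "continuously_differentiable (Suc 0) p" and R: "\<forall>x. R < norm x \<longrightarrow> p x = 0"
  shows "integrable lebesgue (\<lambda>x. real DIM('a) * p x + gradient p x \<bullet> x)"
    and "(LINT x|lebesgue. real DIM('a) * p x + gradient p x \<bullet> x) = 0"
proof -
  let ?h = "\<lambda>b x. p x * (x \<bullet> b)"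
  have h: "continuously_differentiable (Suc 0) (?h b)" for b
    using p by (intro continuously_differentiable_mult continuously_differentiable_inner)
  have h': "frechet_derivative (?h b) (at x) b = p x + (x \<bullet> b) * (gradient p x \<bullet> b)"
    if "b \<in> Basis" for b x
  proof -
    note D = continuously_differentiable_has_derivative[OF p, of x]
    have "(?h b has_derivative (\<lambda>y. p x * (y \<bullet> b) + frechet_derivative p (at x) y * (x \<bullet> b))) (at x)"
      by (intro has_derivative_mult[OF D] derivative_intros)
    then show ?thesis
      using that by (simp add: frechet_derivative_at[symmetric] gradient_inner_Basis)
  qed
  have sum: "real DIM('a) * p x + gradient p x \<bullet> x = (\<Sum>b\<in>Basis. frechet_derivative (?h b) (at x) b)"
    for x
    by (simp add: h' sum.distrib euclidean_inner[of "gradient p x" x] mult.commute)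
  note I = integral_partial_derivative_eq_0[OF h, of R]
  show "integrable lebesgue (\<lambda>x. real DIM('a) * p x + gradient p x \<bullet> x)"
    unfolding sum using R by (intro Bochner_Integration.integrable_sum I) auto
  show "(LINT x|lebesgue. real DIM('a) * p x + gradient p x \<bullet> x) = 0"
    unfolding sum using R
    by (subst Bochner_Integration.integral_sum) (auto intro!: I simp: I(2) simp del: One_nat_def)
qed

lemma integration_by_parts:
  fixes f \<phi> :: "'a::euclidean_space \<Rightarrow> real"
  assumes f: "continuously_differentiable (Suc 0) f"
    and \<phi>: "continuously_differentiable (Suc 0) \<phi>" and R: "\<forall>x. R < norm x \<longrightarrow> \<phi> x = 0"
    and b: "b \<in> Basis"
  shows "(LINT x|lebesgue. f x * (gradient \<phi> x \<bullet> b)) = - (LINT x|lebesgue. \<phi> x * (gradient f x \<bullet> b))"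
proof -
  note cd = f \<phi>
  let ?h = "\<lambda>x. f x * \<phi> x"
  have h': "frechet_derivative ?h (at x) b = f x * (gradient \<phi> x \<bullet> b) + \<phi> x * (gradient f x \<bullet> b)" for x
    using has_derivative_mult[OF cd[THEN continuously_differentiable_has_derivative, of x]] b
    by (simp add: frechet_derivative_at[symmetric] gradient_inner_Basis)
  have c: "continuous_on UNIV f" "continuous_on UNIV \<phi>"
    "continuous_on UNIV (gradient f)" "continuous_on UNIV (gradient \<phi>)"
    by (intro continuously_differentiable_imp_continuous_on[OF cd(1)]
        continuously_differentiable_imp_continuous_on[OF cd(2)] continuous_on_gradient cd)+
  have i: "integrable lebesgue (\<lambda>x. f x * (gradient \<phi> x \<bullet> b))"
    "integrable lebesgue (\<lambda>x. \<phi> x * (gradient f x \<bullet> b))"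
    using R gradient_eq_0_outside[OF R]
    by (auto intro!: integrable_continuous_bounded_support[where R = R] continuous_intros c)
  have "continuously_differentiable (Suc 0) ?h"
    using cd by (rule continuously_differentiable_mult)
  from integral_partial_derivative_eq_0(2)[OF this _ b, of R]
  show ?thesis
    unfolding h' using i R by simp
qed

text \<open>Up to a constant factor, \<open>(1 + |x|\<^sup>2/a) ^ N\<close> dominates \<open>\<Prod>b. (1 + x\<^sub>b\<^sup>2)\<close>, so Fubini's theorem reduces
the claim to the integrability of \<open>1/(1 + t\<^sup>2)\<close> on the line.\<close>
lemma integrable_decay:
  fixes a :: real
  assumes "a > 0"
  shows "integrable lebesgue (\<lambda>x::'a::euclidean_space. (1 + (norm x)\<^sup>2 / a) powr (- real DIM('a)))"
proof -
  interpret product_sigma_finite "\<lambda>_::'a. lborel :: real measure"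
    by standard
  let ?P = "\<lambda>x::'a. \<Prod>b\<in>Basis. 1 / (1 + (x \<bullet> b)\<^sup>2)"
  have "integrable lborel (\<lambda>t::real. 1 / (1 + t\<^sup>2))"
    using integrable_inverse_1_plus_square
    by (simp add: set_integrable_def divide_inverse)
  then have "integrable (\<Pi>\<^sub>M b\<in>(Basis::'a set). lborel) (\<lambda>f :: 'a \<Rightarrow> real. \<Prod>b\<in>Basis. 1 / (1 + (f b)\<^sup>2) :: real)"
    by (intro product_integrable_prod[where f = "\<lambda>_ t. 1 / (1 + t\<^sup>2)"]) auto
  moreover have "?P (\<Sum>b\<in>Basis. f b *\<^sub>R b) = (\<Prod>b\<in>Basis. 1 / (1 + (f b)\<^sup>2))" for f :: "'a \<Rightarrow> real"
    by (intro prod.cong) (simp_all add: inner_sum_left inner_Basis if_distrib cong: if_cong)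
  ultimately have P: "integrable lborel ?P"
    by (subst lborel_eq, subst integrable_distr_eq) (auto simp: space_PiM)
  define c where "c = (1 + a) ^ DIM('a)"
  have "(1 + (norm x)\<^sup>2 / a) powr (- real DIM('a)) \<le> c * ?P x" for x :: 'a
  proof -
    have "1 + (x \<bullet> b)\<^sup>2 \<le> (1 + a) * (1 + (norm x)\<^sup>2 / a)" if "b \<in> Basis" for b
    proof -
      have "1 + (x \<bullet> b)\<^sup>2 \<le> 1 + (norm x)\<^sup>2"
        using Basis_le_norm[OF that, of x] abs_le_square_iff[of "x \<bullet> b" "norm x"] by simp
      also have "\<dots> \<le> (1 + a) * (1 + (norm x)\<^sup>2 / a)"
        using assms by (simp add: field_simps)
      finally show ?thesis .
    qed
    then have "(\<Prod>b\<in>(Basis::'a set). 1 + (x \<bullet> b)\<^sup>2) \<le> (\<Prod>b\<in>(Basis::'a set). (1 + a) * (1 + (norm x)\<^sup>2 / a))"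
      by (intro prod_mono) auto
    then have "(\<Prod>b\<in>(Basis::'a set). 1 + (x \<bullet> b)\<^sup>2) \<le> c * (1 + (norm x)\<^sup>2 / a) ^ DIM('a)"
      by (simp add: c_def power_mult_distrib)
    moreover have "0 < (\<Prod>b\<in>(Basis::'a set). 1 + (x \<bullet> b)\<^sup>2)"
      by (intro prod_pos) (simp add: add_pos_nonneg)
    moreover have "0 < 1 + (norm x)\<^sup>2 / a"
      using assms by (simp add: add_pos_nonneg)
    ultimately show ?thesis
      by (simp add: powr_minus_divide powr_realpow prod_dividef field_simps)
  qed
  then have "integrable lborel (\<lambda>x::'a. (1 + (norm x)\<^sup>2 / a) powr (- real DIM('a)))"
    by (intro Bochner_Integration.integrable_bound[OF integrable_mult_right[OF P, of c]])
      (auto intro!: order_trans[OF _ abs_ge_self])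
  then show ?thesis
    by (simp add: integrable_completion)
qed

section \<open>A smooth radial cutoff\<close>

text \<open>This function equals \<open>1\<close> at \<open>0\<close> and vanishes from \<open>1\<close> on. It is only ever applied to nonnegative
arguments, so its behaviour on the negative half-line is immaterial; nor does it have to be constant near
\<open>0\<close>, since \<open>cutoff (r\<^sup>2/n)\<close> converges to \<open>1\<close> pointwise.\<close>
definition cutoff :: "real \<Rightarrow> real" where
  "cutoff t = exp 1 * flat_poly 1 (1 - t)"

definition cutoff_deriv :: "real \<Rightarrow> real" where
  "cutoff_deriv t = - (exp 1 * flat_poly [:0, 0, 1:] (1 - t))"

lemma cutoff_has_real_derivative:
  "(cutoff has_real_derivative cutoff_deriv t) (at t)"
proof -
  have "(flat_poly 1 has_real_derivative flat_poly [:0, 0, 1:] (1 - t)) (at (1 - t))"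
    using flat_poly_has_real_derivative[of 1 "1 - t"] by (simp add: pderiv_1)
  then show ?thesis
    unfolding cutoff_def cutoff_deriv_def
    by (auto intro!: derivative_eq_intros DERIV_chain2[where f = "flat_poly 1"])
qed

lemma cutoff_0 [simp]: "cutoff 0 = 1"
  by (simp add: cutoff_def flat_poly_def flip: exp_add)

lemma cutoff_eq_0: "t \<ge> 1 \<Longrightarrow> cutoff t = 0" "t \<ge> 1 \<Longrightarrow> cutoff_deriv t = 0"
  by (simp_all add: cutoff_def cutoff_deriv_def flat_poly_def)

lemma cutoff_bounds:
  assumes "t \<ge> 0"
  shows "0 \<le> cutoff t" "cutoff t \<le> 1" "\<bar>cutoff_deriv t\<bar> \<le> 6"
proof -
  show "0 \<le> cutoff t"
    by (simp add: cutoff_def flat_poly_def)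
  have "exp 1 * exp (- (1 / (1 - t))) \<le> 1" if "t < 1"
    using assms that by (simp add: field_simps flip: exp_add)
  then show "cutoff t \<le> 1"
    by (simp add: cutoff_def flat_poly_def)
  have *: "s * s * exp (- s) \<le> 2" if "s > 0" for s :: real
  proof -
    have "s\<^sup>2 / fact 2 \<le> exp s"
    proof -
      have "(\<Sum>n\<in>{2}. s ^ n / fact n) \<le> (\<Sum>n. s ^ n / fact n)"
        using that summable_exp_generic[of s]
        by (intro sum_le_suminf) (auto simp: scaleR_conv_of_real field_simps)
      then show ?thesis
        by (simp add: exp_def scaleR_conv_of_real field_simps)
    qed
    then show ?thesis
      by (simp add: exp_minus field_simps power2_eq_square)
  qed
  have "exp (1::real) \<le> 3"
    by (rule exp_le)
  moreover have "0 \<le> flat_poly [:0, 0, 1:] (1 - t)" "flat_poly [:0, 0, 1:] (1 - t) \<le> 2"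
    using *[of "1 / (1 - t)"] by (auto simp: flat_poly_def)
  ultimately have "exp 1 * flat_poly [:0, 0, 1:] (1 - t) \<le> 3 * 2"
    by (intro mult_mono) auto
  then show "\<bar>cutoff_deriv t\<bar> \<le> 6"
    using \<open>0 \<le> flat_poly [:0, 0, 1:] (1 - t)\<close> by (simp add: cutoff_deriv_def abs_mult)
qed

lemma cutoff_radial:
  assumes "m \<ge> 1"
  shows "continuously_differentiable k (\<lambda>x::'a::euclidean_space. cutoff ((norm x)\<^sup>2 / m))"
    and "m < norm (x::'a) \<Longrightarrow> cutoff ((norm x)\<^sup>2 / m) = 0"
proof -
  have "continuously_differentiable k (\<lambda>x::'a. exp 1 * flat_poly 1 (1 - (1 / m) * (norm x)\<^sup>2))"
    by (intro continuously_differentiable_mult continuously_differentiable_const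
        continuously_differentiable_flat_poly continuously_differentiable_diff
        continuously_differentiable_norm_square)
  then show "continuously_differentiable k (\<lambda>x::'a. cutoff ((norm x)\<^sup>2 / m))"
    by (simp add: cutoff_def)
  assume "m < norm x"
  then have "m * 1 \<le> norm x * norm x"
    using assms by (intro mult_mono) auto
  then show "cutoff ((norm x)\<^sup>2 / m) = 0"
    using assms by (intro cutoff_eq_0) (simp add: power2_eq_square)
qed

lemma cutoff_tendsto_1: "(\<lambda>n. cutoff (t / real (Suc n))) \<longlonglongrightarrow> 1"
proof -
  have "(\<lambda>n. t * inverse (real (Suc n))) \<longlonglongrightarrow> t * 0"
    by (intro tendsto_intros LIMSEQ_inverse_real_of_nat)
  then have "(\<lambda>n. t / real (Suc n)) \<longlonglongrightarrow> 0"
    by (simp add: divide_inverse)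
  from isCont_tendsto_compose[OF DERIV_isCont[OF cutoff_has_real_derivative] this]
  show ?thesis by simp
qed

section \<open>Uniqueness of weak gradients\<close>

lemma locally_integrable_continuous:
  assumes "continuous_on UNIV f"
  shows "locally_integrable f"
  unfolding locally_integrable_def
  using borel_integrable_compact[OF _ continuous_on_subset[OF assms]]
  by (auto simp: set_integrable_def integrable_completion intro!: borel_measurable_scaleR
      borel_measurable_continuous_onI[OF assms] borel_compact)

lemma flat_poly_1_tendsto_1:
  assumes "c > 0"
  shows "(\<lambda>n. flat_poly 1 (real (Suc n) * c)) \<longlonglongrightarrow> 1"
proof -
  have "(\<lambda>n. exp (- (inverse (real (Suc n)) * inverse c))) \<longlonglongrightarrow> exp (- (0 * inverse c))"
    by (intro tendsto_intros LIMSEQ_inverse_real_of_nat)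
  moreover have "flat_poly 1 (real (Suc n) * c) = exp (- (inverse (real (Suc n)) * inverse c))" for n
  proof -
    have "0 < real (Suc n) * c"
      using assms by (intro mult_pos_pos) auto
    then show ?thesis
      by (simp add: flat_poly_def divide_inverse del: of_nat_Suc)
  qed
  ultimately show ?thesis
    by simp
qed

text \<open>With \<open>f(t) = exp(-1/t)\<close>, the test functions \<open>\<Prod>b. f(n (x\<^sub>b - l\<^sub>b)) f(n (u\<^sub>b - x\<^sub>b))\<close> are bounded by the
indicator function of the box and converge to it pointwise.\<close>
lemma test_integrals_zero_imp_box_integral_zero:
  fixes g :: "'a::euclidean_space \<Rightarrow> real"
  assumes g: "locally_integrable g"
    and zero: "\<And>\<phi>. test_function \<phi> \<Longrightarrow> (LINT x|lebesgue. \<phi> x * g x) = 0"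
  shows "(LINT x:box l u|lebesgue. g x) = 0"
proof -
  define \<phi> where "\<phi> n x = (\<Prod>b\<in>Basis. flat_poly 1 (real (Suc n) * (x \<bullet> b - l \<bullet> b)) *
    flat_poly 1 (real (Suc n) * (u \<bullet> b - x \<bullet> b)))" for n and x :: 'a
  have flat01: "0 \<le> flat_poly 1 t" "flat_poly 1 t \<le> 1" for t
    by (auto simp: flat_poly_def)
  have bnd: "\<bar>\<phi> n x\<bar> \<le> 1" for n x
    unfolding \<phi>_def abs_prod
    by (intro prod_le_1) (auto simp: abs_mult flat01 intro: mult_le_one)
  have out: "\<phi> n x = 0" if "x \<notin> box l u" for n x
  proof -
    from that obtain b where b: "b \<in> Basis" "x \<bullet> b \<le> l \<bullet> b \<or> u \<bullet> b \<le> x \<bullet> b"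
      by (auto simp: box_def not_less)
    then have "flat_poly 1 (real (Suc n) * (x \<bullet> b - l \<bullet> b)) = 0 \<or>
        flat_poly 1 (real (Suc n) * (u \<bullet> b - x \<bullet> b)) = 0"
      by (auto simp: flat_poly_def zero_less_mult_iff)
    then show ?thesis
      unfolding \<phi>_def using b(1) by (intro prod_zero[OF finite_Basis]) auto
  qed
  have lim: "(\<lambda>n. \<phi> n x) \<longlonglongrightarrow> indicator (box l u) x" for x
  proof (cases "x \<in> box l u")
    case True
    have "(\<lambda>n. \<phi> n x) \<longlonglongrightarrow> (\<Prod>b\<in>(Basis::'a set). 1 * 1)"
      unfolding \<phi>_def using True
      by (intro tendsto_prod tendsto_mult flat_poly_1_tendsto_1) (auto simp: box_def)
    then show ?thesis using True by simp
  qed (simp add: out)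
  have smooth: "continuously_differentiable k (\<phi> n)" for k n
    unfolding \<phi>_def
    by (intro continuously_differentiable_prod continuously_differentiable_mult
        continuously_differentiable_const continuously_differentiable_flat_poly
        continuously_differentiable_diff continuously_differentiable_inner)
  have test: "test_function (\<phi> n)" for n
  proof -
    obtain R where "\<forall>x\<in>box l u. norm x \<le> R"
      using bounded_box[of l u] by (auto simp: bounded_iff)
    then show ?thesis
      unfolding test_function_iff using smooth out by (metis not_le)
  qed
  have g_box: "integrable lebesgue (\<lambda>x. indicator (box l u) x * g x)"
    "integrable lebesgue (\<lambda>x. indicator (cbox l u) x * g x)"
  proof -
    have "set_integrable lebesgue (cbox l u) g"
      using g by (auto simp: locally_integrable_def)
    moreover from this have "set_integrable lebesgue (box l u) g"
      by (rule set_integrable_subset) (auto simp: box_subset_cbox)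
    ultimately show "integrable lebesgue (\<lambda>x. indicator (box l u) x * g x)"
      "integrable lebesgue (\<lambda>x. indicator (cbox l u) x * g x)"
      by (simp_all add: set_integrable_def)
  qed
  have \<phi>g: "\<phi> n x * g x = \<phi> n x * (indicator (box l u) x * g x)" for n x
    using out by (cases "x \<in> box l u") auto
  have "(\<lambda>n. LINT x|lebesgue. \<phi> n x * (indicator (box l u) x * g x)) \<longlonglongrightarrow>
      (LINT x|lebesgue. indicator (box l u) x * (indicator (box l u) x * g x))"
  proof (rule integral_dominated_convergence[where w = "\<lambda>x. \<bar>indicator (box l u) x * g x\<bar>"])
    have m: "(\<lambda>x. indicator (box l u) x * g x) \<in> borel_measurable lebesgue"
      using g_box by (simp add: borel_measurable_integrable)
    have "\<phi> n \<in> borel_measurable lebesgue" for n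
      using smooth[of 0 n] by (intro borel_measurable_lebesgue_continuous) simp
    then show "(\<lambda>x. \<phi> n x * (indicator (box l u) x * g x)) \<in> borel_measurable lebesgue" for n
      using m by (rule borel_measurable_times)
    show "(\<lambda>x. indicator (box l u) x * (indicator (box l u) x * g x)) \<in> borel_measurable lebesgue"
      using m by (intro borel_measurable_times[OF _ m] borel_measurable_indicator) auto
    show "AE x in lebesgue. (\<lambda>n. \<phi> n x * (indicator (box l u) x * g x)) \<longlonglongrightarrow>
        indicator (box l u) x * (indicator (box l u) x * g x)"
      by (intro AE_I2 tendsto_mult lim tendsto_const)
    show "AE x in lebesgue. norm (\<phi> n x * (indicator (box l u) x * g x)) \<le>
        \<bar>indicator (box l u) x * g x\<bar>" for n
      using bnd by (intro AE_I2) (auto simp: abs_mult intro!: mult_left_le_one_le)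
  qed (use g_box in auto)
  then have "(LINT x|lebesgue. indicator (box l u) x * (indicator (box l u) x * g x)) = 0"
    using zero[OF test] LIMSEQ_unique[OF _ tendsto_const] by (simp flip: \<phi>g)
  then show ?thesis
    by (simp add: set_lebesgue_integral_def mult.assoc[symmetric] flip: indicator_inter_arith)
qed

text \<open>Boxes form an intersection-stable generator of the Borel sets, so the vanishing of the integrals
extends from boxes to all Borel sets. On each bounded box the function is first replaced by a Borel
measurable one that agrees with it almost everywhere.\<close>
lemma test_integrals_zero_imp_AE_zero:
  fixes g :: "'a::euclidean_space \<Rightarrow> real"
  assumes g: "locally_integrable g"
    and zero: "\<And>\<phi>. test_function \<phi> \<Longrightarrow> (LINT x|lebesgue. \<phi> x * g x) = 0"
  shows "AE x in lebesgue. g x = 0"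
proof -
  have "AE x in lebesgue. x \<in> box l u \<longrightarrow> g x = 0" for l u
  proof -
    let ?G = "range (\<lambda>(a, b). box a b :: 'a set)"
    let ?f = "\<lambda>x. indicator (box l u) x * g x"
    have "set_integrable lebesgue (cbox l u) g"
      using g by (auto simp: locally_integrable_def)
    then have "set_integrable lebesgue (box l u) g"
      by (rule set_integrable_subset) (auto simp: box_subset_cbox)
    then have f: "integrable lebesgue ?f"
      by (simp add: set_integrable_def)
    then obtain h where h: "h \<in> borel_measurable lborel" "AE x in lborel. ?f x = h x"
      using completion_ex_borel_measurable_real[OF borel_measurable_integrable] by blast
    have hf: "AE x in lebesgue. ?f x = h x"
      using h(2) by (rule AE_completion)
    have hl: "h \<in> borel_measurable lebesgue"
      using h(1) by (rule measurable_completion)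
    have inth: "integrable lborel h"
      using integrable_cong_AE[OF borel_measurable_integrable[OF f] hl hf] f h(1)
      by (simp add: integrable_completion)
    have eq: "(LINT x:A|lborel. h x) = (LINT x:A|lebesgue. ?f x)" if "A \<in> sets borel" for A
    proof -
      have "(LINT x:A|lborel. h x) = (LINT x:A|lebesgue. h x)"
        using that h(1) unfolding set_lebesgue_integral_def
        by (subst integral_completion) auto
      also have "\<dots> = (LINT x:A|lebesgue. ?f x)"
        unfolding set_lebesgue_integral_def
        using that hf hl borel_measurable_integrable[OF f]
        by (intro integral_cong_AE borel_measurable_scaleR borel_measurable_indicator) auto
      finally show ?thesis .
    qed
    have int: "set_integrable lborel A h" if "A \<in> sets borel" for A
      using inth that unfolding set_integrable_def by (intro integrable_mult_indicator) auto
    have gen: "sets (borel :: 'a measure) = sigma_sets UNIV ?G"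
      by (subst borel_eq_box) (simp add: sets_measure_of)
    have stable: "Int_stable ?G"
      by (auto simp: Int_stable_def box_Int_box)
    have box0: "(LINT x:box a b|lborel. h x) = 0" for a b
    proof -
      have "(LINT x:box a b|lborel. h x) = (LINT x:box a b|lebesgue. ?f x)"
        by (rule eq) simp
      also have "\<dots> = (LINT x:box a b \<inter> box l u|lebesgue. g x)"
        by (simp add: set_lebesgue_integral_def indicator_inter_arith mult.assoc)
      finally have "(LINT x:box a b|lborel. h x) = (LINT x:box a b \<inter> box l u|lebesgue. g x)" .
      then show ?thesis
        using test_integrals_zero_imp_box_integral_zero[OF g zero]
        by (simp add: box_Int_box)
    qed
    have total: "(LINT x|lborel. h x) = 0"
    proof -
      have "(LINT x|lborel. h x) = (LINT x:UNIV|lborel. h x)"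
        by (simp add: set_lebesgue_integral_def)
      also have "\<dots> = (LINT x:UNIV|lebesgue. ?f x)"
        by (rule eq) simp
      also have "\<dots> = (LINT x:box l u|lebesgue. g x)"
        by (simp add: set_lebesgue_integral_def)
      finally show ?thesis
        using test_integrals_zero_imp_box_integral_zero[OF g zero] by simp
    qed
    have all: "(LINT x:A|lborel. h x) = 0" if "A \<in> sets borel" for A
    proof -
      have "A \<in> sigma_sets UNIV ?G" "?G \<subseteq> Pow UNIV"
        using that gen by auto
      from stable this(2,1) show ?thesis
      proof (induction rule: sigma_sets_induct_disjoint)
        case (compl A)
        have A: "A \<in> sets borel"
          using compl gen by simp
        have "(LINT x:UNIV - A|lborel. h x) = (LINT x|lborel. h x - indicator A x *\<^sub>R h x)"
          unfolding set_lebesgue_integral_def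
          by (rule Bochner_Integration.integral_cong) (auto simp: indicator_def)
        also have "\<dots> = (LINT x|lborel. h x) - (LINT x:A|lborel. h x)"
          using int[OF A] inth unfolding set_integrable_def set_lebesgue_integral_def
          by (rule Bochner_Integration.integral_diff[rotated])
        finally show ?case
          using compl total by simp
      next
        case (union A)
        have A: "A i \<in> sets borel" for i
          using union(2) gen by auto
        have "(LINT x:(\<Union>i. A i)|lborel. h x) = (\<Sum>i. LINT x:A i|lborel. h x)"
        proof (rule lebesgue_integral_countable_add)
          show "A i \<inter> A j = {}" if "i \<noteq> j" for i j
            using union(1) that by (rule disjoint_family_onD[OF _ UNIV_I UNIV_I])
          show "set_integrable lborel (\<Union>i. A i) h"
            using A by (intro int sets.countable_UN) blast
        qed (use A in simp)
        then show ?case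
          using union(3) by simp
      next
        case (basic A)
        then show ?case
          using box0 by auto
      qed (simp add: set_lebesgue_integral_def)
    qed
    have "AE x in lborel. h x = 0"
      by (rule sigma_finite_measure.density_zero[OF sigma_finite_lborel inth]) (use all in auto)
    then have "AE x in lebesgue. h x = 0"
      by (rule AE_completion)
    with hf show ?thesis
    proof eventually_elim
      case (elim x)
      then show ?case
        by (cases "x \<in> box l u") simp_all
    qed
  qed
  then have "AE x in lebesgue. \<forall>n::nat. x \<in> box (- (real n *\<^sub>R One)) (real n *\<^sub>R One) \<longrightarrow> g x = 0"
    unfolding AE_all_countable by (rule allI)
  then show ?thesis
  proof eventually_elim
    case (elim x)
    have "x \<in> (\<Union>n::nat. box (- (real n *\<^sub>R One)) (real n *\<^sub>R One))"
      by (simp only: UN_box_eq_UNIV UNIV_I)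
    then obtain n :: nat where "x \<in> box (- (real n *\<^sub>R One)) (real n *\<^sub>R One)"
      by (rule UN_E)
    with elim[rule_format, of n] show ?case .
  qed
qed

lemma weak_gradient_unique_AE:
  fixes v :: "'a::euclidean_space \<Rightarrow> real"
  assumes G: "has_weak_gradient v G" and H: "has_weak_gradient v H"
  shows "AE x in lebesgue. G x = H x"
proof -
  have "AE x in lebesgue. (G x - H x) \<bullet> b = 0" if b: "b \<in> Basis" for b
  proof (rule test_integrals_zero_imp_AE_zero)
    have loc: "locally_integrable G" "locally_integrable H"
      using G H by (auto simp: has_weak_gradient_def)
    show "locally_integrable (\<lambda>x. (G x - H x) \<bullet> b)"
      unfolding locally_integrable_def
    proof (intro allI impI)
      fix K :: "'a set" assume "compact K"
      then have "integrable lebesgue (\<lambda>x. indicator K x *\<^sub>R G x - indicator K x *\<^sub>R H x)"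
        using loc unfolding locally_integrable_def set_integrable_def
        by (intro Bochner_Integration.integrable_diff) blast+
      then have "integrable lebesgue (\<lambda>x. (indicator K x *\<^sub>R G x - indicator K x *\<^sub>R H x) \<bullet> b)"
        by (rule integrable_inner_left)
      then show "set_integrable lebesgue K (\<lambda>x. (G x - H x) \<bullet> b)"
        by (simp add: set_integrable_def scaleR_right_diff_distrib[symmetric])
    qed
    fix \<phi> :: "'a \<Rightarrow> real" assume \<phi>: "test_function \<phi>"
    then obtain R where R: "\<forall>x. R < norm x \<longrightarrow> \<phi> x = 0"
      by (auto simp: test_function_iff)
    have c: "continuous_on UNIV \<phi>"
      using \<phi> continuously_differentiable.simps(1) unfolding test_function_def by blast
    have "bounded (\<phi> ` cball 0 R)"
      by (intro compact_imp_bounded compact_continuous_image compact_cball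
        continuous_on_subset[OF c]) simp
    then obtain C where C: "C > 0" "\<And>x. x \<in> cball 0 R \<Longrightarrow> norm (\<phi> x) \<le> C"
      by (auto simp: bounded_pos)
    have i: "integrable lebesgue (\<lambda>x. \<phi> x * (F x \<bullet> b))" if "locally_integrable F" for F
    proof -
      have "integrable lebesgue (\<lambda>x. indicator (cball 0 R) x *\<^sub>R F x)"
        using that by (simp add: locally_integrable_def set_integrable_def)
      then have I: "integrable lebesgue (\<lambda>x. (indicator (cball 0 R) x *\<^sub>R F x) \<bullet> b)"
        by (rule integrable_inner_left)
      have m: "\<phi> \<in> borel_measurable lebesgue"
        using c by (rule borel_measurable_lebesgue_continuous)
      have "integrable lebesgue (\<lambda>x. \<phi> x * ((indicator (cball 0 R) x *\<^sub>R F x) \<bullet> b))"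
      proof (rule Bochner_Integration.integrable_bound[OF integrable_mult_right[OF I, of C]])
        show "(\<lambda>x. \<phi> x * ((indicator (cball 0 R) x *\<^sub>R F x) \<bullet> b)) \<in> borel_measurable lebesgue"
          using I m by (intro borel_measurable_times) auto
        show "AE x in lebesgue. norm (\<phi> x * ((indicator (cball 0 R) x *\<^sub>R F x) \<bullet> b)) \<le>
            norm (C * ((indicator (cball 0 R) x *\<^sub>R F x) \<bullet> b))"
          using C by (intro AE_I2) (auto simp: abs_mult indicator_def intro!: mult_right_mono)
      qed
      also have "(\<lambda>x. \<phi> x * ((indicator (cball 0 R) x *\<^sub>R F x) \<bullet> b)) = (\<lambda>x. \<phi> x * (F x \<bullet> b))"
        using R by (auto simp: fun_eq_iff indicator_def)
      finally show ?thesis .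
    qed
    have "(LINT x|lebesgue. v x * (gradient \<phi> x \<bullet> b)) = - (LINT x|lebesgue. \<phi> x * (F x \<bullet> b))"
      if "has_weak_gradient v F" for F
      using that \<phi> b by (simp add: has_weak_gradient_def)
    from this[OF G] this[OF H]
    have "(LINT x|lebesgue. \<phi> x * (G x \<bullet> b)) = (LINT x|lebesgue. \<phi> x * (H x \<bullet> b))"
      by simp
    then show "(LINT x|lebesgue. \<phi> x * ((G x - H x) \<bullet> b)) = 0"
      using i[OF loc(1)] i[OF loc(2)] by (simp add: inner_diff_left right_diff_distrib)
  qed
  then have "AE x in lebesgue. \<forall>b\<in>Basis. (G x - H x) \<bullet> b = 0"
    by (subst AE_finite_all) auto
  then show ?thesis
    by eventually_elim (auto simp: euclidean_eq_iff[of "G _"] inner_diff_left)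
qed

section \<open>A Picone inequality for radial fields\<close>

text \<open>This is \<open>div F + |F|\<^sup>2\<close> for the field \<open>F(x) = Q(x) x\<close>, the zeroth order coefficient in the expansion of
\<open>\<integral> |\<nabla>\<psi> - \<psi> F|\<^sup>2\<close>.\<close>
definition radial_expansion :: "('a::euclidean_space \<Rightarrow> real) \<Rightarrow> 'a \<Rightarrow> real" where
  "radial_expansion Q x = real DIM('a) * Q x + gradient Q x \<bullet> x + (norm x)\<^sup>2 * (Q x)\<^sup>2"

lemma continuous_on_radial_expansion:
  "continuously_differentiable (Suc 0) Q \<Longrightarrow> continuous_on UNIV (radial_expansion Q)"
  unfolding radial_expansion_def
  by (intro continuous_intros continuous_on_gradient
      continuously_differentiable_imp_continuous_on[of "Suc 0"])

lemma radial_expansion_eq_0_outside: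
  "\<forall>x. R < norm x \<longrightarrow> Q x = 0 \<Longrightarrow> R < norm x \<Longrightarrow> radial_expansion Q x = 0"
  using gradient_eq_0_outside[of R Q x] by (simp add: radial_expansion_def)

text \<open>Expand the square in \<open>0 \<le> \<integral> |\<nabla>\<psi> - \<psi> Q x|\<^sup>2\<close>. The mixed term is \<open>\<nabla>(\<psi>\<^sup>2) \<bullet> Q x\<close>, which is moved onto
the field by the vanishing integral of the divergence of \<open>\<psi>\<^sup>2 Q x\<close>.\<close>
lemma picone_inequality:
  fixes \<psi> Q :: "'a::euclidean_space \<Rightarrow> real"
  assumes \<psi>: "continuously_differentiable (Suc 0) \<psi>" and R: "\<forall>x. R < norm x \<longrightarrow> \<psi> x = 0"
    and Q: "continuously_differentiable (Suc 0) Q"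
  shows "- (LINT x|lebesgue. (\<psi> x)\<^sup>2 * radial_expansion Q x)
    \<le> (LINT x|lebesgue. (norm (gradient \<psi> x))\<^sup>2)"
proof -
  let ?p = "\<lambda>x. \<psi> x * \<psi> x * Q x"
  have p: "continuously_differentiable (Suc 0) ?p"
    by (intro continuously_differentiable_mult \<psi> Q)
  have grad: "gradient ?p x \<bullet> x = 2 * \<psi> x * Q x * (gradient \<psi> x \<bullet> x) + (\<psi> x)\<^sup>2 * (gradient Q x \<bullet> x)" for x
  proof -
    note d = continuously_differentiable_has_derivative[OF \<psi>, of x]
      continuously_differentiable_has_derivative[OF Q, of x]
    show ?thesis
      unfolding gradient_inner[OF has_derivative_mult[OF has_derivative_mult[OF d(1) d(1)] d(2)]]
        gradient_inner[OF d(1)] gradient_inner[OF d(2)]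
      by (simp add: algebra_simps power2_eq_square)
  qed
  note c = continuously_differentiable_imp_continuous_on[OF \<psi>] continuous_on_gradient[OF \<psi>]
    continuous_on_radial_expansion[OF Q]
  have i: "integrable lebesgue (\<lambda>x. (norm (gradient \<psi> x))\<^sup>2)"
    "integrable lebesgue (\<lambda>x. (\<psi> x)\<^sup>2 * radial_expansion Q x)"
    using R gradient_eq_0_outside[OF R]
    by (auto intro!: integrable_continuous_bounded_support[where R = R] continuous_intros c)
  have "\<forall>x. R < norm x \<longrightarrow> ?p x = 0"
    using R by auto
  note div = integral_divergence_radial_field_eq_0[OF p this]
  have "0 \<le> (norm (gradient \<psi> x - (\<psi> x * Q x) *\<^sub>R x))\<^sup>2" for x
    by simp
  also have "(norm (gradient \<psi> x - (\<psi> x * Q x) *\<^sub>R x))\<^sup>2 = (norm (gradient \<psi> x))\<^sup>2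
      + (\<psi> x)\<^sup>2 * radial_expansion Q x - (real DIM('a) * ?p x + gradient ?p x \<bullet> x)" for x
  proof -
    have square: "(norm (gradient \<psi> x - c *\<^sub>R x))\<^sup>2
        = (norm (gradient \<psi> x))\<^sup>2 - 2 * c * (gradient \<psi> x \<bullet> x) + c * c * (norm x)\<^sup>2" for c
      by (simp add: power2_norm_eq_inner inner_diff_left inner_diff_right inner_commute
          algebra_simps)
    show ?thesis
      unfolding square[of "\<psi> x * Q x"] grad radial_expansion_def
      by (simp add: algebra_simps power2_eq_square)
  qed
  finally have "0 \<le> (LINT x|lebesgue. (norm (gradient \<psi> x))\<^sup>2 + (\<psi> x)\<^sup>2 * radial_expansion Q x
      - (real DIM('a) * ?p x + gradient ?p x \<bullet> x))"
    by (intro Bochner_Integration.integral_nonneg) simp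
  also have "\<dots> = (LINT x|lebesgue. (norm (gradient \<psi> x))\<^sup>2)
      + (LINT x|lebesgue. (\<psi> x)\<^sup>2 * radial_expansion Q x)"
    by (subst Bochner_Integration.integral_diff[OF Bochner_Integration.integrable_add[OF i] div(1)])
      (simp only: div(2) Bochner_Integration.integral_add[OF i] diff_zero)
  finally show ?thesis by simp
qed

text \<open>A smooth substitute for truncation at height \<open>k\<close>: it is bounded by \<open>k\<close>, has slope at most \<open>1\<close>, and composing
it with a test function keeps both the smoothness and the support.\<close>
definition truncate :: "real \<Rightarrow> real \<Rightarrow> real" where
  "truncate k s = k * sin (s / k)"

lemma truncate_0 [simp]: "truncate k 0 = 0"
  by (simp add: truncate_def)

lemma abs_truncate_le:
  assumes "k > 0" shows "\<bar>truncate k s\<bar> \<le> \<bar>s\<bar>" "\<bar>truncate k s\<bar> \<le> k"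
  using assms abs_sin_x_le_abs_x[of "s / k"] abs_sin_le_one[of "s / k"]
  by (auto simp: truncate_def abs_mult field_simps)

lemma truncate_square_lipschitz:
  assumes "k > 0"
  shows "\<bar>(truncate k s)\<^sup>2 - (truncate k t)\<^sup>2\<bar> \<le> 2 * k * \<bar>s - t\<bar>"
proof -
  define a b where "a = s / k" and "b = t / k"
  have "\<bar>sin a - sin b\<bar> = \<bar>2 * sin ((a - b) / 2) * cos ((a + b) / 2)\<bar>"
    by (simp add: sin_diff_sin)
  also have "\<dots> \<le> 2 * \<bar>(a - b) / 2\<bar> * 1"
    unfolding abs_mult by (intro mult_mono abs_sin_x_le_abs_x) auto
  finally have 1: "\<bar>sin a - sin b\<bar> \<le> \<bar>a - b\<bar>"
    by simp
  have "\<bar>sin a + sin b\<bar> \<le> 2"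
    using abs_triangle_ineq[of "sin a" "sin b"] abs_sin_le_one[of a] abs_sin_le_one[of b] by linarith
  then have "\<bar>sin a + sin b\<bar> * \<bar>sin a - sin b\<bar> \<le> 2 * \<bar>a - b\<bar>"
    using 1 by (intro mult_mono) auto
  then have "k\<^sup>2 * (\<bar>sin a + sin b\<bar> * \<bar>sin a - sin b\<bar>) \<le> k\<^sup>2 * (2 * \<bar>a - b\<bar>)"
    by (intro mult_left_mono) auto
  also have "k\<^sup>2 * (2 * \<bar>a - b\<bar>) = 2 * k * \<bar>s - t\<bar>"
    using assms by (simp add: a_def b_def power2_eq_square abs_divide flip: diff_divide_distrib)
  also have "k\<^sup>2 * (\<bar>sin a + sin b\<bar> * \<bar>sin a - sin b\<bar>) = \<bar>(truncate k s)\<^sup>2 - (truncate k t)\<^sup>2\<bar>"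
  proof -
    have "(truncate k s)\<^sup>2 - (truncate k t)\<^sup>2 = k\<^sup>2 * ((sin a + sin b) * (sin a - sin b))"
      by (simp add: truncate_def a_def b_def power2_eq_square algebra_simps)
    then show ?thesis
      by (simp add: abs_mult)
  qed
  finally show ?thesis .
qed

lemma truncate_tendsto: "(\<lambda>n. truncate (real (Suc n)) s) \<longlonglongrightarrow> s"
proof (cases "s = 0")
  case False
  have "((\<lambda>h. sin h / h) \<longlongrightarrow> 1) (at (0::real))"
    using DERIV_sin[of 0] by (simp add: DERIV_def)
  moreover have "filterlim (\<lambda>n. s / real (Suc n)) (at 0) sequentially"
  proof -
    have "(\<lambda>n. s * inverse (real (Suc n))) \<longlonglongrightarrow> s * 0"
      by (intro tendsto_intros LIMSEQ_inverse_real_of_nat)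
    then show ?thesis
      using False by (auto simp: filterlim_at divide_inverse)
  qed
  ultimately have "(\<lambda>n. sin (s / real (Suc n)) / (s / real (Suc n))) \<longlonglongrightarrow> 1"
    by (rule filterlim_compose)
  from tendsto_mult_left[OF this, of s] show ?thesis
    using False by (simp add: truncate_def mult.commute)
qed (simp add: truncate_def)

lemma picone_inequality_truncated:
  fixes \<phi> Q :: "'a::euclidean_space \<Rightarrow> real"
  assumes \<phi>: "test_function \<phi>" and Q: "continuously_differentiable (Suc 0) Q" and k: "k > 0"
  shows "- (LINT x|lebesgue. (truncate k (\<phi> x))\<^sup>2 * radial_expansion Q x)
    \<le> (LINT x|lebesgue. (norm (gradient \<phi> x))\<^sup>2)"
proof -
  from \<phi> obtain R where smooth: "\<And>j. continuously_differentiable j \<phi>"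
    and R: "\<forall>x. R < norm x \<longrightarrow> \<phi> x = 0"
    by (auto simp: test_function_iff)
  let ?\<psi> = "\<lambda>x. truncate k (\<phi> x)"
  have \<psi>: "continuously_differentiable (Suc 0) ?\<psi>"
  proof -
    have "continuously_differentiable (Suc 0) (\<lambda>x. k * sin (1 / k * \<phi> x))"
      by (intro continuously_differentiable_mult continuously_differentiable_const
          continuously_differentiable_sin smooth)
    then show ?thesis by (simp add: truncate_def)
  qed
  have R': "\<forall>x. R < norm x \<longrightarrow> ?\<psi> x = 0"
    using R by simp
  have grad: "gradient ?\<psi> x = cos (\<phi> x / k) *\<^sub>R gradient \<phi> x" for x
  proof (rule gradient_eqI)
    note d = continuously_differentiable_has_derivative[OF smooth, of x]
    have "(truncate k has_real_derivative cos (\<phi> x / k)) (at (\<phi> x))"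
      unfolding truncate_def using k by (auto intro!: derivative_eq_intros)
    from DERIV_compose_FDERIV[OF this d]
    show "(?\<psi> has_derivative (\<lambda>y. (cos (\<phi> x / k) *\<^sub>R gradient \<phi> x) \<bullet> y)) (at x)"
      by (simp add: gradient_inner[OF d] mult.commute)
  qed
  have "- (LINT x|lebesgue. (?\<psi> x)\<^sup>2 * radial_expansion Q x)
      \<le> (LINT x|lebesgue. (norm (gradient ?\<psi> x))\<^sup>2)"
    by (rule picone_inequality[OF \<psi> R' Q])
  also have "\<dots> \<le> (LINT x|lebesgue. (norm (gradient \<phi> x))\<^sup>2)"
  proof (rule integral_mono)
    show "integrable lebesgue (\<lambda>x. (norm (gradient ?\<psi> x))\<^sup>2)"
      using gradient_eq_0_outside[OF R']
      by (auto intro!: integrable_continuous_bounded_support[where R = R] continuous_intros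
          continuous_on_gradient \<psi>)
    show "integrable lebesgue (\<lambda>x. (norm (gradient \<phi> x))\<^sup>2)"
      using gradient_eq_0_outside[OF R]
      by (auto intro!: integrable_continuous_bounded_support[where R = R] continuous_intros
          continuous_on_gradient smooth)
    show "(norm (gradient ?\<psi> x))\<^sup>2 \<le> (norm (gradient \<phi> x))\<^sup>2" for x
      unfolding grad
      by (intro power_mono) (auto intro: mult_left_le_one_le)
  qed
  finally show ?thesis .
qed

lemma locally_integrable_imp_measurable:
  fixes v :: "'a::euclidean_space \<Rightarrow> 'b::{banach, second_countable_topology}"
  assumes "locally_integrable v"
  shows "v \<in> borel_measurable lebesgue"
proof (rule borel_measurable_LIMSEQ_metric)
  show "(\<lambda>x. indicator (cball 0 (real n)) x *\<^sub>R v x) \<in> borel_measurable lebesgue" for n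
    using assms[unfolded locally_integrable_def, rule_format, OF compact_cball]
    unfolding set_integrable_def by (rule borel_measurable_integrable)
  show "(\<lambda>n. indicator (cball 0 (real n)) x *\<^sub>R v x) \<longlonglongrightarrow> v x" for x
  proof (rule tendsto_eventually)
    obtain n0 where "norm x \<le> real n0"
      using real_arch_simple by blast
    then have "indicator (cball 0 (real n)) x *\<^sub>R v x = v x" if "n \<ge> n0" for n
      using that by (simp add: indicator_def)
    then show "\<forall>\<^sub>F n in sequentially. indicator (cball 0 (real n)) x *\<^sub>R v x = v x"
      by (auto simp: eventually_sequentially)
  qed
qed

lemma truncate_measurable:
  "v \<in> borel_measurable M \<Longrightarrow> (\<lambda>x. truncate k (v x)) \<in> borel_measurable M"
  by (erule measurable_compose, rule borel_measurable_continuous_onI)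
    (auto simp: truncate_def divide_inverse intro!: continuous_intros)

text \<open>On the right-hand side convergence of the gradients in \<open>L\<^sup>2\<close> is enough. On the left-hand side the
coefficient is bounded with compact support, and the square of the truncation is Lipschitz
continuous, so convergence in \<open>L\<^sup>1\<close> on compact sets is enough as well.\<close>
lemma picone_inequality_truncated_limit:
  fixes v Q :: "'a::euclidean_space \<Rightarrow> real" and \<phi> :: "nat \<Rightarrow> 'a \<Rightarrow> real"
  assumes v: "locally_integrable v" and G: "square_integrable G"
    and \<phi>: "\<And>n. test_function (\<phi> n)"
    and L1: "\<And>K. compact K \<Longrightarrow> (\<lambda>n. LINT x:K|lebesgue. \<bar>\<phi> n x - v x\<bar>) \<longlonglongrightarrow> 0"
    and grad: "(\<lambda>n. LINT x|lebesgue. (norm (gradient (\<phi> n) x - G x))\<^sup>2) \<longlonglongrightarrow> 0"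
    and Q: "continuously_differentiable (Suc 0) Q" and R: "\<forall>x. R < norm x \<longrightarrow> Q x = 0"
    and k: "k > 0"
  shows "- (LINT x|lebesgue. (truncate k (v x))\<^sup>2 * radial_expansion Q x)
    \<le> (LINT x|lebesgue. (norm (G x))\<^sup>2)"
proof -
  define W where "W = radial_expansion Q"
  define A where "A = (LINT x|lebesgue. (norm (G x))\<^sup>2)"
  define e where "e n = (LINT x|lebesgue. (norm (gradient (\<phi> n) x - G x))\<^sup>2)" for n
  define I where "I u = (LINT x|lebesgue. (truncate k (u x))\<^sup>2 * W x)" for u :: "'a \<Rightarrow> real"
  have Wcont: "continuous_on UNIV W"
    unfolding W_def using Q by (rule continuous_on_radial_expansion)
  have Wout: "W x = 0" if "R < norm x" for x
    unfolding W_def using R that by (rule radial_expansion_eq_0_outside)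
  have "bounded (W ` cball 0 R)"
    by (intro compact_imp_bounded compact_continuous_image compact_cball
        continuous_on_subset[OF Wcont]) simp
  then obtain C where C: "C > 0" "\<And>x. x \<in> cball 0 R \<Longrightarrow> norm (W x) \<le> C"
    by (auto simp: bounded_pos)
  have intW: "integrable lebesgue W"
    using Wcont Wout by (intro integrable_continuous_bounded_support) auto
  have smooth: "continuously_differentiable j (\<phi> n)" for j n
    using \<phi> by (simp add: test_function_def)
  have \<phi>cont: "continuous_on UNIV (\<phi> n)" for n
    using continuously_differentiable_imp_continuous_on[OF smooth] .
  have int_trunc: "integrable lebesgue (\<lambda>x. (truncate k (u x))\<^sup>2 * W x)"
    if "u \<in> borel_measurable lebesgue" for u
  proof (rule Bochner_Integration.integrable_bound[OF integrable_mult_right[OF intW, of "k\<^sup>2"]])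
    show "(\<lambda>x. (truncate k (u x))\<^sup>2 * W x) \<in> borel_measurable lebesgue"
      using truncate_measurable[OF that] intW by (intro borel_measurable_times borel_measurable_power) auto
    show "AE x in lebesgue. norm ((truncate k (u x))\<^sup>2 * W x) \<le> norm (k\<^sup>2 * W x)"
      using abs_truncate_le(2)[OF k] k
      by (intro AE_I2) (auto simp: abs_mult intro!: mult_right_mono simp flip: abs_le_square_iff)
  qed
  have vm: "v \<in> borel_measurable lebesgue"
    using v by (rule locally_integrable_imp_measurable)
  have lim: "(\<lambda>n. I (\<phi> n)) \<longlonglongrightarrow> I v"
  proof (rule Lim_null_comparison[THEN LIM_zero_cancel])
    show "\<forall>\<^sub>F n in sequentially. norm (I (\<phi> n) - I v)
        \<le> 2 * k * C * (LINT x:cball 0 R|lebesgue. \<bar>\<phi> n x - v x\<bar>)"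
    proof (intro always_eventually allI)
      fix n
      have i1: "integrable lebesgue (\<lambda>x. (truncate k (\<phi> n x))\<^sup>2 * W x)"
        "integrable lebesgue (\<lambda>x. (truncate k (v x))\<^sup>2 * W x)"
        using int_trunc vm borel_measurable_lebesgue_continuous[OF \<phi>cont] by auto
      have "set_integrable lebesgue (cball 0 R) (\<lambda>x. \<phi> n x - v x)"
        using v locally_integrable_continuous[OF \<phi>cont, of n]
        by (intro set_integral_diff) (auto simp: locally_integrable_def)
      then have i2: "set_integrable lebesgue (cball 0 R) (\<lambda>x. \<bar>\<phi> n x - v x\<bar>)"
        by (rule set_integrable_abs)
      have "I (\<phi> n) - I v = (LINT x|lebesgue. ((truncate k (\<phi> n x))\<^sup>2 - (truncate k (v x))\<^sup>2) * W x)"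
        unfolding I_def left_diff_distrib using i1 by simp
      also have "norm \<dots> \<le> (LINT x|lebesgue. 2 * k * C * (indicator (cball 0 R) x *\<^sub>R \<bar>\<phi> n x - v x\<bar>))"
      proof (rule Bochner_Integration.integral_norm_bound_integral)
        show "integrable lebesgue (\<lambda>x. ((truncate k (\<phi> n x))\<^sup>2 - (truncate k (v x))\<^sup>2) * W x)"
          unfolding left_diff_distrib using i1 by (rule Bochner_Integration.integrable_diff)
        show "integrable lebesgue (\<lambda>x. 2 * k * C * (indicator (cball 0 R) x *\<^sub>R \<bar>\<phi> n x - v x\<bar>))"
          using i2 unfolding set_integrable_def by (rule integrable_mult_right)
        fix x
        show "norm (((truncate k (\<phi> n x))\<^sup>2 - (truncate k (v x))\<^sup>2) * W x)
            \<le> 2 * k * C * (indicator (cball 0 R) x *\<^sub>R \<bar>\<phi> n x - v x\<bar>)"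
        proof (cases "norm x \<le> R")
          case True
          have "\<bar>(truncate k (\<phi> n x))\<^sup>2 - (truncate k (v x))\<^sup>2\<bar> * \<bar>W x\<bar> \<le> (2 * k * \<bar>\<phi> n x - v x\<bar>) * C"
            using True C k by (intro mult_mono truncate_square_lipschitz) auto
          then show ?thesis
            using True by (simp add: abs_mult indicator_def mult_ac)
        qed (simp add: Wout not_le)
      qed
      finally show "norm (I (\<phi> n) - I v) \<le> 2 * k * C * (LINT x:cball 0 R|lebesgue. \<bar>\<phi> n x - v x\<bar>)"
        by (simp add: set_lebesgue_integral_def)
    qed
    show "(\<lambda>n. 2 * k * C * (LINT x:cball 0 R|lebesgue. \<bar>\<phi> n x - v x\<bar>)) \<longlonglongrightarrow> 0"
      using tendsto_mult_right_zero[OF L1[OF compact_cball]] by blast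
  qed
  have Gm: "G \<in> borel_measurable lebesgue" and Gi: "integrable lebesgue (\<lambda>x. (norm (G x))\<^sup>2)"
    using G by (auto simp: square_integrable_def)
  \<comment> \<open>Young's inequality compares the two Dirichlet integrals up to a factor \<open>1 + \<delta>\<close> and a multiple of
    the \<open>L\<^sup>2\<close> distance of the gradients; \<open>\<delta>\<close> tends to zero after \<open>n\<close> tends to infinity.\<close>
  have step: "- I (\<phi> n) \<le> (1 + \<delta>) * A + (1 + 1 / \<delta>) * e n" if \<delta>: "\<delta> > 0" for n \<delta>
  proof -
    from \<phi>[of n] obtain r where r: "\<forall>x. r < norm x \<longrightarrow> \<phi> n x = 0"
      by (auto simp: test_function_iff)
    have gc: "continuous_on UNIV (gradient (\<phi> n))"
      using smooth by (rule continuous_on_gradient)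
    have gi: "integrable lebesgue (\<lambda>x. (norm (gradient (\<phi> n) x))\<^sup>2)"
      using gradient_eq_0_outside[OF r]
      by (auto intro!: integrable_continuous_bounded_support[where R = r] continuous_intros gc)
    have young: "(norm (p + q))\<^sup>2 \<le> (1 + \<delta>) * (norm p)\<^sup>2 + (1 + 1 / \<delta>) * (norm q)\<^sup>2"
      if "\<delta> > 0" for p q :: 'a and \<delta> :: real
    proof -
      have "2 * (norm p * norm q) \<le> \<delta> * (norm p)\<^sup>2 + 1 / \<delta> * (norm q)\<^sup>2"
      proof -
        have "0 \<le> (\<delta> * norm p - norm q)\<^sup>2 / \<delta>"
          using that by simp
        also have "\<dots> = \<delta> * (norm p)\<^sup>2 + 1 / \<delta> * (norm q)\<^sup>2 - 2 * (norm p * norm q)"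
          using that by (simp add: field_simps power2_eq_square)
        finally show ?thesis by simp
      qed
      moreover have "(norm (p + q))\<^sup>2 \<le> (norm p + norm q)\<^sup>2"
        by (intro power_mono norm_triangle_ineq) auto
      ultimately show ?thesis
        by (simp add: power2_eq_square algebra_simps)
    qed
    have di: "integrable lebesgue (\<lambda>x. (norm (gradient (\<phi> n) x - G x))\<^sup>2)"
    proof (rule Bochner_Integration.integrable_bound)
      show "integrable lebesgue (\<lambda>x. 2 * (norm (gradient (\<phi> n) x))\<^sup>2 + 2 * (norm (G x))\<^sup>2)"
        using gi Gi by simp
      show "(\<lambda>x. (norm (gradient (\<phi> n) x - G x))\<^sup>2) \<in> borel_measurable lebesgue"
        using Gm borel_measurable_lebesgue_continuous[OF gc]
        by (intro borel_measurable_power borel_measurable_norm[THEN measurable_compose[rotated]] borel_measurable_diff) auto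
      show "AE x in lebesgue. norm ((norm (gradient (\<phi> n) x - G x))\<^sup>2)
          \<le> norm (2 * (norm (gradient (\<phi> n) x))\<^sup>2 + 2 * (norm (G x))\<^sup>2)"
        using young[of 1 "gradient (\<phi> n) _" "- G _"] by (intro AE_I2) auto
    qed
    have "- I (\<phi> n) \<le> (LINT x|lebesgue. (norm (gradient (\<phi> n) x))\<^sup>2)"
      unfolding I_def W_def by (rule picone_inequality_truncated[OF \<phi> Q k])
    also have "\<dots> \<le> (LINT x|lebesgue. (1 + \<delta>) * (norm (G x))\<^sup>2
        + (1 + 1 / \<delta>) * (norm (gradient (\<phi> n) x - G x))\<^sup>2)"
    proof (rule integral_mono[OF gi])
      show "(norm (gradient (\<phi> n) x))\<^sup>2 \<le> (1 + \<delta>) * (norm (G x))\<^sup>2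
        + (1 + 1 / \<delta>) * (norm (gradient (\<phi> n) x - G x))\<^sup>2" for x
        using young[OF \<delta>, of "G x" "gradient (\<phi> n) x - G x"] by simp
    qed (use Gi di in simp)
    also have "\<dots> = (1 + \<delta>) * A + (1 + 1 / \<delta>) * e n"
      using Gi di by (simp add: A_def e_def)
    finally show ?thesis .
  qed
  have scaled: "- I v \<le> (1 + \<delta>) * A" if "\<delta> > 0" for \<delta>
  proof (rule LIMSEQ_le)
    show "(\<lambda>n. - I (\<phi> n)) \<longlonglongrightarrow> - I v"
      using lim by (rule tendsto_minus)
    have "(\<lambda>n. (1 + \<delta>) * A + (1 + 1 / \<delta>) * e n) \<longlonglongrightarrow> (1 + \<delta>) * A + (1 + 1 / \<delta>) * 0"
      using grad unfolding e_def by (intro tendsto_intros)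
    then show "(\<lambda>n. (1 + \<delta>) * A + (1 + 1 / \<delta>) * e n) \<longlonglongrightarrow> (1 + \<delta>) * A"
      by simp
  qed (use step[OF that] in auto)
  have "A \<ge> 0"
    unfolding A_def by (intro Bochner_Integration.integral_nonneg) simp
  have "- I v \<le> A + \<epsilon>" if "\<epsilon> > 0" for \<epsilon>
  proof -
    have "- I v \<le> A + \<epsilon> / (A + 1) * A"
      using scaled[of "\<epsilon> / (A + 1)"] \<open>A \<ge> 0\<close> that by (simp add: distrib_right)
    also have "\<epsilon> / (A + 1) * A \<le> \<epsilon>"
      using \<open>A \<ge> 0\<close> that by (simp add: field_simps)
    finally show ?thesis by simp
  qed
  then show ?thesis
    unfolding I_def A_def W_def by (rule field_le_epsilon)
qed

section \<open>The lower bound\<close>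

lemma norm_square_has_derivative:
  "((\<lambda>x::'a::euclidean_space. (norm x)\<^sup>2) has_derivative (\<lambda>y. 2 * (x \<bullet> y))) (at x)"
  unfolding power2_norm_eq_inner
  by (auto intro!: derivative_eq_intros simp: inner_commute)

lemma gradient_radial:
  fixes x :: "'a::euclidean_space"
  assumes "(q has_real_derivative d) (at ((norm x)\<^sup>2))"
  shows "gradient (\<lambda>x. q ((norm x)\<^sup>2)) x = (2 * d) *\<^sub>R x"
  by (rule gradient_eqI)
    (use DERIV_compose_FDERIV[OF assms norm_square_has_derivative] in \<open>simp add: mult_ac\<close>)

text \<open>The regularised coefficient \<open>q\<close>, as a function of \<open>t = r\<^sup>2\<close>: the limit \<open>m \<rightarrow> \<infinity>\<close> is the logarithmic
derivative \<open>1/t - N/(a + t)\<close> of the minimiser divided by \<open>r\<close>. The shift by \<open>1/m\<close> removes the singularity at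
the origin.\<close>
definition profile :: "real \<Rightarrow> real \<Rightarrow> real \<Rightarrow> real \<Rightarrow> real" where
  "profile a N m t = cutoff (t / m) * (1 / (t + 1 / m) - N / (a + t))"

definition profile_deriv :: "real \<Rightarrow> real \<Rightarrow> real \<Rightarrow> real \<Rightarrow> real" where
  "profile_deriv a N m t =
    cutoff_deriv (t / m) / m * (1 / (t + 1 / m) - N / (a + t)) +
    cutoff (t / m) * (N / (a + t)\<^sup>2 - 1 / (t + 1 / m)\<^sup>2)"

text \<open>For \<open>Q(x) = q(r\<^sup>2)\<close> one has \<open>\<nabla>Q \<bullet> x = 2 t q'(t)\<close>, so this is the radial expansion of the profile in
the variable \<open>t\<close>.\<close>
definition profile_weight :: "real \<Rightarrow> real \<Rightarrow> real \<Rightarrow> real \<Rightarrow> real" where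
  "profile_weight a N m t =
    N * profile a N m t + 2 * t * profile_deriv a N m t + t * (profile a N m t)\<^sup>2"

lemma cutoff_scaled_has_real_derivative:
  "((\<lambda>t. cutoff (t / m)) has_real_derivative cutoff_deriv (t / m) / m) (at t)"
  using DERIV_chain2[OF cutoff_has_real_derivative DERIV_cdivide[OF DERIV_ident], of m t]
  by simp

lemma profile_has_real_derivative:
  assumes "a > 0" "m > 0" "t \<ge> 0"
  shows "(profile a N m has_real_derivative profile_deriv a N m t) (at t)"
proof -
  have pos: "t + 1 / m > 0" "a + t > 0"
    using assms by (auto simp: add_nonneg_pos)
  have "((\<lambda>t. 1 / (t + 1 / m) - N / (a + t)) has_real_derivative
      N / (a + t)\<^sup>2 - 1 / (t + 1 / m)\<^sup>2) (at t)"
    using pos by (auto intro!: derivative_eq_intros simp: power2_eq_square)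
  from DERIV_mult[OF cutoff_scaled_has_real_derivative[of m t] this]
  show ?thesis
    unfolding profile_def profile_deriv_def by (simp add: add.commute mult.commute)
qed

lemma cutoff_deriv_scaled_bound:
  assumes "t \<ge> 0" "m > 0"
  shows "\<bar>cutoff_deriv (t / m) * (t / m)\<bar> \<le> 6"
proof (cases "t / m \<le> 1")
  case True
  have "\<bar>cutoff_deriv (t / m)\<bar> * \<bar>t / m\<bar> \<le> 6 * 1"
    using True assms by (intro mult_mono cutoff_bounds) auto
  then show ?thesis by (simp only: abs_mult)
qed (simp add: cutoff_eq_0)

text \<open>The bound does not depend on \<open>m\<close>: in terms of \<open>p = t/(t + 1/m)\<close> and \<open>r = t/(a + t)\<close>, both in \<open>[0, 1]\<close>,
the quantities \<open>t q\<close> and \<open>t\<^sup>2 q'\<close> become \<open>\<chi> (p - N r)\<close> and \<open>\<chi>' (t/m) (p - N r) + \<chi> (N r\<^sup>2 - p\<^sup>2)\<close>, and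
\<open>\<chi>' (t/m)\<close> is bounded because the cutoff ends at \<open>t = m\<close>.\<close>
lemma profile_weight_bound:
  assumes "a > 0" "m > 0" "t \<ge> 0" "N \<ge> 1"
  shows "t * \<bar>profile_weight a N m t\<bar> \<le> 2 * N\<^sup>2 + 14 * N"
proof -
  define p r where "p = t / (t + 1 / m)" and "r = t / (a + t)"
  have pos: "t + 1 / m > 0" "a + t > 0"
    using assms by (auto simp: add_nonneg_pos)
  have p: "0 \<le> p" "p \<le> 1" and r: "0 \<le> r" "r \<le> 1"
    using assms pos by (auto simp: p_def r_def)
  have g: "\<bar>p - N * r\<bar> \<le> N"
  proof -
    have "0 \<le> N * r" "N * r \<le> N"
      using r assms(4) by (auto intro: mult_left_le)
    then show ?thesis
      using p assms(4) by linarith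
  qed
  have g': "\<bar>N * r\<^sup>2 - p\<^sup>2\<bar> \<le> N"
  proof -
    have "0 \<le> N * r\<^sup>2" "N * r\<^sup>2 \<le> N" "0 \<le> p\<^sup>2" "p\<^sup>2 \<le> 1"
      using p r assms(4) by (auto intro: mult_left_le power_le_one)
    then show ?thesis
      using assms(4) by linarith
  qed
  define c where "c = cutoff (t / m)"
  have c: "0 \<le> c" "c \<le> 1"
    using assms cutoff_bounds[of "t / m"] by (auto simp: c_def)
  define d where "d = cutoff_deriv (t / m) * (t / m)"
  have d: "\<bar>d\<bar> \<le> 6"
    unfolding d_def by (rule cutoff_deriv_scaled_bound) fact+
  have tp: "t * profile a N m t = c * (p - N * r)"
    by (simp add: profile_def p_def r_def c_def algebra_simps)
  have td: "t * t * profile_deriv a N m t = d * (p - N * r) + c * (N * r\<^sup>2 - p\<^sup>2)"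
    by (simp add: profile_deriv_def p_def r_def c_def d_def algebra_simps power2_eq_square)
  have b1: "\<bar>c * (p - N * r)\<bar> \<le> N"
    using mult_mono[OF c(2) g] c by (simp add: abs_mult)
  have b2: "\<bar>d * (p - N * r)\<bar> \<le> 6 * N"
    using mult_mono[OF d g] by (simp add: abs_mult)
  have b3: "\<bar>c * (N * r\<^sup>2 - p\<^sup>2)\<bar> \<le> N"
    using mult_mono[OF c(2) g'] c by (simp add: abs_mult)
  have "t * profile_weight a N m t =
      N * (t * profile a N m t) + 2 * (t * t * profile_deriv a N m t) + (t * profile a N m t)\<^sup>2"
    by (simp add: profile_weight_def algebra_simps power2_eq_square)
  also have "\<bar>\<dots>\<bar> \<le> N * N + 2 * (6 * N + N) + N\<^sup>2"
  proof -
    have "\<bar>N * (c * (p - N * r))\<bar> \<le> N * N"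
      using b1 assms(4) by (simp add: abs_mult)
    moreover have "\<bar>d * (p - N * r) + c * (N * r\<^sup>2 - p\<^sup>2)\<bar> \<le> 6 * N + N"
      using b2 b3 by linarith
    moreover have "(c * (p - N * r))\<^sup>2 \<le> N\<^sup>2"
      using b1 assms(4) by (simp flip: abs_le_square_iff)
    ultimately show ?thesis
      unfolding tp td by (smt (verit) zero_le_power2)
  qed
  finally show ?thesis
    using assms(3) by (simp add: abs_mult power2_eq_square algebra_simps)
qed

lemma inverse_Suc_tendsto_0: "(\<lambda>n. 1 / real (Suc n)) \<longlonglongrightarrow> 0"
  using LIMSEQ_inverse_real_of_nat by (simp add: inverse_eq_divide)

lemma cutoff_deriv_tendsto_0:
  assumes "t \<ge> 0"
  shows "(\<lambda>n. cutoff_deriv (t / real (Suc n)) / real (Suc n)) \<longlonglongrightarrow> 0"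
proof (rule Lim_null_comparison)
  show "\<forall>\<^sub>F n in sequentially.
      norm (cutoff_deriv (t / real (Suc n)) / real (Suc n)) \<le> 6 * (1 / real (Suc n))"
    using cutoff_bounds(3)[of "t / real (Suc _)"] assms
    by (intro always_eventually allI) (simp add: divide_right_mono)
  show "(\<lambda>n. 6 * (1 / real (Suc n))) \<longlonglongrightarrow> 0"
    by (intro tendsto_mult_right_zero inverse_Suc_tendsto_0)
qed

text \<open>The limit is \<open>(N - 1)/r\<^sup>2 - V\<close>, which is where the potential and the constant \<open>N - 1\<close> come from.\<close>
lemma profile_weight_tendsto:
  assumes "a > 0" "t > 0"
  shows "(\<lambda>n. profile_weight a N (real (Suc n)) t) \<longlonglongrightarrow>
    (N - 1) / t - N * (N + 2) * a / (a + t)\<^sup>2"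
proof -
  have nz: "t + 0 \<noteq> 0" "(t + 0)\<^sup>2 \<noteq> 0" "a + t \<noteq> 0"
    using assms by auto
  have p: "(\<lambda>n. profile a N (real (Suc n)) t) \<longlonglongrightarrow> 1 * (1 / (t + 0) - N / (a + t))"
    unfolding profile_def
    by (intro tendsto_intros cutoff_tendsto_1 inverse_Suc_tendsto_0 nz)
  have d: "(\<lambda>n. profile_deriv a N (real (Suc n)) t) \<longlonglongrightarrow>
      0 * (1 / (t + 0) - N / (a + t)) + 1 * (N / (a + t)\<^sup>2 - 1 / (t + 0)\<^sup>2)"
    unfolding profile_deriv_def
    by (intro tendsto_intros cutoff_tendsto_1 cutoff_deriv_tendsto_0 inverse_Suc_tendsto_0 nz
        less_imp_le assms)
  have "(\<lambda>n. profile_weight a N (real (Suc n)) t) \<longlonglongrightarrow>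
    N * (1 * (1 / (t + 0) - N / (a + t))) +
    2 * t * (0 * (1 / (t + 0) - N / (a + t)) + 1 * (N / (a + t)\<^sup>2 - 1 / (t + 0)\<^sup>2)) +
    t * (1 * (1 / (t + 0) - N / (a + t)))\<^sup>2"
    unfolding profile_weight_def by (intro tendsto_intros p d)
  also have "N * (1 * (1 / (t + 0) - N / (a + t))) +
    2 * t * (0 * (1 / (t + 0) - N / (a + t)) + 1 * (N / (a + t)\<^sup>2 - 1 / (t + 0)\<^sup>2)) +
    t * (1 * (1 / (t + 0) - N / (a + t)))\<^sup>2 = (N - 1) / t - N * (N + 2) * a / (a + t)\<^sup>2"
  proof -
    define y where "y = 1 / (a + t)"
    have y: "y * (a + t) = 1"
      using assms by (simp add: y_def)
    define z where "z = 1 / t"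
    have z: "z * t = 1"
      using assms by (simp add: z_def)
    have "N * (z - N * y) + 2 * t * (N * y\<^sup>2 - z\<^sup>2) + t * (z - N * y)\<^sup>2 =
        (N - 1) * z - N * (N + 2) * a * y\<^sup>2"
      using y z by algebra
    then show ?thesis
      using assms by (simp add: y_def z_def power_divide)
  qed
  finally show ?thesis .
qed

text \<open>The number \<open>a\<close> for which the Liouville and Yamabe bubbles are functions of \<open>1 + r\<^sup>2/a\<close>.\<close>
definition bubble_scale :: "real \<Rightarrow> real" where
  "bubble_scale N = (if N = 2 then 8 else N * (N - 2))"

lemma bubble_scale_pos: "N \<ge> 2 \<Longrightarrow> bubble_scale N > 0"
  by (auto simp: bubble_scale_def)

lemma potential_eq:
  fixes x :: "'a::euclidean_space"
  assumes "DIM('a) \<ge> 2"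
  defines "N \<equiv> real DIM('a)"
  shows "potential x = N * (N + 2) * bubble_scale N / (bubble_scale N + (norm x)\<^sup>2)\<^sup>2"
proof (cases "DIM('a) = 2")
  case True
  have "8 + (norm x)\<^sup>2 > 0"
    by (simp add: add_pos_nonneg)
  then show ?thesis
    using True by (simp add: potential_def N_def bubble_scale_def power2_eq_square field_simps)
next
  case False
  then have N: "N > 2"
    using assms by simp
  then have "N - 2 \<noteq> 0" by simp
  then show ?thesis
    using False N by (simp add: potential_def N_def[symmetric] Let_def bubble_scale_def power2_eq_square)
qed

lemma profile_field:
  fixes a m :: real
  assumes "a > 0" "m \<ge> 1"
  defines "Q \<equiv> \<lambda>x::'a::euclidean_space. profile a (real DIM('a)) m ((norm x)\<^sup>2)"
  shows "continuously_differentiable k Q"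
    and "\<forall>x. m < norm x \<longrightarrow> Q x = 0"
    and "radial_expansion Q x = profile_weight a (real DIM('a)) m ((norm x)\<^sup>2)"
proof -
  have "continuously_differentiable k (\<lambda>x::'a. cutoff ((norm x)\<^sup>2 / m) *
      (1 / ((norm x)\<^sup>2 + 1 / m) - real DIM('a) * (1 / (a + (norm x)\<^sup>2))))"
    using assms(1,2)
    by (intro continuously_differentiable_mult continuously_differentiable_diff
        cutoff_radial continuously_differentiable_inverse continuously_differentiable_add
        continuously_differentiable_norm_square continuously_differentiable_const)
      (auto intro: add_nonneg_pos add_pos_nonneg)
  then show "continuously_differentiable k Q"
    by (simp add: Q_def profile_def)
  show "\<forall>x. m < norm x \<longrightarrow> Q x = 0"
    using cutoff_radial(2)[OF assms(2), where 'a = 'a] by (simp add: Q_def profile_def)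
  have "gradient Q x = (2 * profile_deriv a (real DIM('a)) m ((norm x)\<^sup>2)) *\<^sub>R x"
    unfolding Q_def using assms(1,2) by (intro gradient_radial profile_has_real_derivative) auto
  then show "radial_expansion Q x = profile_weight a (real DIM('a)) m ((norm x)\<^sup>2)"
    by (simp add: radial_expansion_def profile_weight_def Q_def power2_norm_eq_inner)
qed

lemma AE_lebesgue_nonzero: "AE x::'a::euclidean_space in lebesgue. x \<noteq> 0"
  by (rule AE_completion[OF AE_lborel_singleton])

lemma integrable_inverse_square_weight:
  "v \<in> D_rad \<Longrightarrow> integrable lebesgue (\<lambda>x. (v x)\<^sup>2 / (norm x)\<^sup>2)"
  by (simp add: D_rad_def L2_inverse_norm_def square_integrable_def power_divide)

text \<open>The cutoff radius, the regularisation at the origin and the truncation height are all governed by the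
same index \<open>n\<close>. The resulting integrands are dominated by a multiple of \<open>v\<^sup>2/r\<^sup>2\<close>.\<close>
lemma hardy_type_inequality:
  fixes v :: "'a::euclidean_space \<Rightarrow> real" and a :: real
  assumes v: "v \<in> D_rad" and a: "a > 0"
  defines "N \<equiv> real DIM('a)"
  defines "w \<equiv> \<lambda>x::'a. (N - 1) / (norm x)\<^sup>2 - N * (N + 2) * a / (a + (norm x)\<^sup>2)\<^sup>2"
  shows "- (LINT x|lebesgue. (v x)\<^sup>2 * w x) \<le> (LINT x|lebesgue. (norm (weak_gradient v x))\<^sup>2)"
proof -
  from v have "v \<in> D12"
    by (simp add: D_rad_def D12_rad_def)
  then obtain \<phi> where loc: "locally_integrable v" and G: "square_integrable (weak_gradient v)"
    and \<phi>: "\<And>n::nat. test_function (\<phi> n)"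
    and L1: "\<And>K. compact K \<Longrightarrow> (\<lambda>n. LINT x:K|lebesgue. \<bar>\<phi> n x - v x\<bar>) \<longlonglongrightarrow> 0"
    and grad: "(\<lambda>n. LINT x|lebesgue. (norm (gradient (\<phi> n) x - weak_gradient v x))\<^sup>2) \<longlonglongrightarrow> 0"
    unfolding D12_def has_weak_gradient_def by blast
  define W where "W n x = profile_weight a N (real (Suc n)) ((norm x)\<^sup>2)" for n and x :: 'a
  have vm: "v \<in> borel_measurable lebesgue"
    using loc by (rule locally_integrable_imp_measurable)
  have le: "- (LINT x|lebesgue. (truncate (real (Suc n)) (v x))\<^sup>2 * W n x)
      \<le> (LINT x|lebesgue. (norm (weak_gradient v x))\<^sup>2)" for n
  proof -
    let ?Q = "\<lambda>x::'a. profile a N (real (Suc n)) ((norm x)\<^sup>2)"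
    note Q = profile_field[OF a, of "real (Suc n)", where 'a = 'a, folded N_def]
    have "radial_expansion ?Q = W n"
      using Q(3) by (auto simp: W_def fun_eq_iff)
    then show ?thesis
      using picone_inequality_truncated_limit[OF loc G \<phi> L1 grad Q(1) Q(2), of "real (Suc n)"]
      by simp
  qed
  have "(\<lambda>n. LINT x|lebesgue. (truncate (real (Suc n)) (v x))\<^sup>2 * W n x) \<longlonglongrightarrow>
      (LINT x|lebesgue. (v x)\<^sup>2 * w x)"
  proof (rule integral_dominated_convergence)
    show "integrable lebesgue (\<lambda>x. (2 * N\<^sup>2 + 14 * N) * ((v x)\<^sup>2 / (norm x)\<^sup>2))"
      using integrable_inverse_square_weight[OF v] by (rule integrable_mult_right)
    have "w \<in> borel_measurable borel"
      unfolding w_def by measurable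
    then have "w \<in> borel_measurable lebesgue"
      by (intro measurable_completion) simp
    then show "(\<lambda>x. (v x)\<^sup>2 * w x) \<in> borel_measurable lebesgue"
      using vm by (intro borel_measurable_times borel_measurable_power)
    show "(\<lambda>x. (truncate (real (Suc n)) (v x))\<^sup>2 * W n x) \<in> borel_measurable lebesgue" for n
    proof (intro borel_measurable_times borel_measurable_power truncate_measurable vm
        borel_measurable_lebesgue_continuous)
      show "continuous_on UNIV (W n)"
        using continuous_on_radial_expansion[OF profile_field(1)[OF a, of "real (Suc n)" "Suc 0", where 'a = 'a]]
          profile_field(3)[OF a, of "real (Suc n)", where 'a = 'a]
        by (simp add: W_def[abs_def] N_def)
    qed
    show "AE x in lebesgue. (\<lambda>n. (truncate (real (Suc n)) (v x))\<^sup>2 * W n x) \<longlonglongrightarrow> (v x)\<^sup>2 * w x"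
      using AE_lebesgue_nonzero
    proof eventually_elim
      case (elim x)
      then show ?case
        unfolding W_def w_def
        by (intro tendsto_intros truncate_tendsto profile_weight_tendsto a) simp
    qed
    show "AE x in lebesgue. norm ((truncate (real (Suc n)) (v x))\<^sup>2 * W n x)
        \<le> (2 * N\<^sup>2 + 14 * N) * ((v x)\<^sup>2 / (norm x)\<^sup>2)" for n
      using AE_lebesgue_nonzero
    proof eventually_elim
      case (elim x)
      have "N \<ge> 1"
        using DIM_positive[where 'a = 'a] by (simp add: N_def Suc_le_eq)
      then have "(norm x)\<^sup>2 * \<bar>W n x\<bar> \<le> 2 * N\<^sup>2 + 14 * N"
        unfolding W_def using a by (intro profile_weight_bound) auto
      then have "\<bar>W n x\<bar> \<le> (2 * N\<^sup>2 + 14 * N) / (norm x)\<^sup>2"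
        using elim by (simp add: field_simps)
      moreover have "(truncate (real (Suc n)) (v x))\<^sup>2 \<le> (v x)\<^sup>2"
        using abs_truncate_le(1)[of "real (Suc n)" "v x"] by (simp flip: abs_le_square_iff)
      ultimately have "(truncate (real (Suc n)) (v x))\<^sup>2 * \<bar>W n x\<bar>
          \<le> (v x)\<^sup>2 * ((2 * N\<^sup>2 + 14 * N) / (norm x)\<^sup>2)"
        by (intro mult_mono) auto
      then show ?case
        by (simp add: abs_mult mult.commute)
    qed
  qed
  then have "(\<lambda>n. - (LINT x|lebesgue. (truncate (real (Suc n)) (v x))\<^sup>2 * W n x)) \<longlonglongrightarrow>
      - (LINT x|lebesgue. (v x)\<^sup>2 * w x)"
    by (rule tendsto_minus)
  then show ?thesis
    by (rule LIMSEQ_le_const2) (use le in blast)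
qed

lemma inverse_square_integral_pos:
  fixes v :: "'a::euclidean_space \<Rightarrow> real"
  assumes "v \<in> admissible"
  shows "(LINT x|lebesgue. (v x)\<^sup>2 / (norm x)\<^sup>2) > 0"
proof -
  have v: "v \<in> D_rad" "\<not> (AE x in lebesgue. v x = 0)"
    using assms by (auto simp: admissible_def)
  have "(LINT x|lebesgue. (v x)\<^sup>2 / (norm x)\<^sup>2) \<noteq> 0"
  proof
    assume "(LINT x|lebesgue. (v x)\<^sup>2 / (norm x)\<^sup>2) = 0"
    then have "AE x in lebesgue. (v x)\<^sup>2 / (norm x)\<^sup>2 = 0"
      using integral_nonneg_eq_0_iff_AE[OF integrable_inverse_square_weight[OF v(1)]] by simp
    then have "AE x in lebesgue. v x = 0"
      using AE_lebesgue_nonzero by eventually_elim auto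
    with v(2) show False ..
  qed
  moreover have "(LINT x|lebesgue. (v x)\<^sup>2 / (norm x)\<^sup>2) \<ge> 0"
    by (intro Bochner_Integration.integral_nonneg) simp
  ultimately show ?thesis
    by (metis less_le)
qed

text \<open>Since \<open>a r\<^sup>2 \<le> (a + r\<^sup>2)\<^sup>2\<close>, the function \<open>V v\<^sup>2\<close> is integrable, and the preceding inequality can be
split into its parts.\<close>
lemma rayleigh_quotient_lower_bound:
  fixes v :: "'a::euclidean_space \<Rightarrow> real"
  assumes v: "v \<in> admissible" and dim: "DIM('a) \<ge> 2"
  shows "- (real DIM('a) - 1) \<le> rayleigh_quotient v"
proof -
  define N where "N = real DIM('a)"
  define a where "a = bubble_scale N"
  have a: "a > 0"
    using dim by (simp add: a_def N_def bubble_scale_pos)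
  have D: "v \<in> D_rad"
    using v by (simp add: admissible_def)
  then have loc: "locally_integrable v" and G: "square_integrable (weak_gradient v)"
    by (auto simp: D_rad_def D12_rad_def D12_def has_weak_gradient_def)
  have V: "potential x = N * (N + 2) * a / (a + (norm x)\<^sup>2)\<^sup>2" for x :: 'a
    using potential_eq[OF dim] by (simp add: N_def a_def)
  note i1 = integrable_inverse_square_weight[OF D]
  have i2: "integrable lebesgue (\<lambda>x. potential x * (v x)\<^sup>2)"
  proof (rule Bochner_Integration.integrable_bound[OF integrable_mult_right[OF i1, of "N * (N + 2)"]])
    have "potential \<in> borel_measurable (borel :: 'a measure)"
      unfolding V[abs_def] by measurable
    then have "(potential :: 'a \<Rightarrow> real) \<in> borel_measurable lebesgue"
      by (intro measurable_completion) simp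
    then show "(\<lambda>x. potential x * (v x)\<^sup>2) \<in> borel_measurable lebesgue"
      using locally_integrable_imp_measurable[OF loc]
      by (intro borel_measurable_times borel_measurable_power)
    show "AE x in lebesgue. norm (potential x * (v x)\<^sup>2)
        \<le> norm (N * (N + 2) * ((v x)\<^sup>2 / (norm x)\<^sup>2))"
      using AE_lebesgue_nonzero
    proof eventually_elim
      case (elim x)
      have "a * (norm x)\<^sup>2 \<le> (a + (norm x)\<^sup>2)\<^sup>2"
        using a by (simp add: power2_sum)
      then have "a / (a + (norm x)\<^sup>2)\<^sup>2 \<le> 1 / (norm x)\<^sup>2"
        using a elim zero_less_power[OF add_pos_nonneg[OF a zero_le_power2[of "norm x"]], of 2]
        by (simp add: divide_le_eq pos_le_divide_eq)
      then have "N * (N + 2) * (v x)\<^sup>2 * (a / (a + (norm x)\<^sup>2)\<^sup>2) \<le> N * (N + 2) * (v x)\<^sup>2 * (1 / (norm x)\<^sup>2)"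
        by (intro mult_left_mono) (auto simp: N_def)
      then show ?case
        using a by (simp add: V N_def abs_mult mult_ac)
    qed
  qed
  have iG: "integrable lebesgue (\<lambda>x. (norm (weak_gradient v x))\<^sup>2)"
    using G by (simp add: square_integrable_def)
  define I where "I = (LINT x|lebesgue. (v x)\<^sup>2 / (norm x)\<^sup>2)"
  have "- (LINT x|lebesgue. (v x)\<^sup>2 * ((N - 1) / (norm x)\<^sup>2 - N * (N + 2) * a / (a + (norm x)\<^sup>2)\<^sup>2))
      \<le> (LINT x|lebesgue. (norm (weak_gradient v x))\<^sup>2)"
    unfolding N_def by (rule hardy_type_inequality[OF D a])
  also have "(\<lambda>x. (v x)\<^sup>2 * ((N - 1) / (norm x)\<^sup>2 - N * (N + 2) * a / (a + (norm x)\<^sup>2)\<^sup>2)) =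
      (\<lambda>x. (N - 1) * ((v x)\<^sup>2 / (norm x)\<^sup>2) - potential x * (v x)\<^sup>2)"
    by (simp add: V fun_eq_iff algebra_simps)
  also have "(LINT x|lebesgue. (N - 1) * ((v x)\<^sup>2 / (norm x)\<^sup>2) - potential x * (v x)\<^sup>2) =
      (N - 1) * I - (LINT x|lebesgue. potential x * (v x)\<^sup>2)"
    unfolding I_def
    by (subst Bochner_Integration.integral_diff[OF integrable_mult_right[OF i1] i2])
      (simp only: integral_mult_right_zero)
  finally have "- (N - 1) * I \<le> (LINT x|lebesgue. (norm (weak_gradient v x))\<^sup>2 - potential x * (v x)\<^sup>2)"
    using iG i2 by (simp add: left_diff_distrib)
  moreover have "I > 0"
    unfolding I_def by (rule inverse_square_integral_pos[OF v])
  ultimately show ?thesis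
    by (simp add: rayleigh_quotient_def N_def I_def[symmetric] pos_le_divide_eq)
qed

section \<open>Smooth approximation of the minimiser\<close>

text \<open>The factor of the minimiser other than \<open>r\<close>, as a function of \<open>t = r\<^sup>2\<close>. It is the natural majorant for
the gradients below, and its square is integrable.\<close>
definition decay :: "real \<Rightarrow> real \<Rightarrow> real \<Rightarrow> real" where
  "decay a N t = (1 + t / a) powr (- (N / 2))"

lemma decay_bounds:
  assumes "a > 0" "t \<ge> 0" "N \<ge> 0"
  shows "0 < decay a N t" "decay a N t \<le> 1"
proof -
  have *: "1 + t / a \<ge> 1"
    using assms by simp
  then show "0 < decay a N t"
    unfolding decay_def by (subst powr_gt_zero) linarith
  have "(1 + t / a) powr (- (N / 2)) \<le> (1 + t / a) powr 0"
    using assms * by (intro powr_mono) auto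
  also have "\<dots> = 1"
  proof -
    have "1 + t / a \<noteq> 0"
      using * by linarith
    then show ?thesis
      by (simp only: powr_zero_eq_one if_False)
  qed
  finally show "decay a N t \<le> 1"
    unfolding decay_def .
qed

lemma decay_has_real_derivative:
  assumes "a > 0" "t \<ge> 0"
  shows "(decay a N has_real_derivative - (N / 2) * decay a N t / (a + t)) (at t)"
proof -
  have pos: "1 + t / a > 0" "a + t > 0"
    using assms by (auto simp: add_pos_nonneg)
  have "((\<lambda>t. (1 + t / a) powr (- (N / 2))) has_real_derivative
      (- (N / 2)) * (1 + t / a) powr (- (N / 2) - 1) * (1 / a)) (at t)"
    by (rule derivative_eq_intros refl | use pos(1) assms(1) in simp)+
  also have "(- (N / 2)) * (1 + t / a) powr (- (N / 2) - 1) * (1 / a) = - (N / 2) * decay a N t / (a + t)"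
  proof -
    have "(1 + t / a) powr (- (N / 2) - 1) = decay a N t / (1 + t / a)"
      using pos(1) by (simp add: decay_def powr_diff)
    moreover have "(1 + t / a) * a = a + t"
      using assms by (simp add: field_simps)
    ultimately show ?thesis
      by (metis divide_divide_eq_left mult.right_neutral times_divide_eq_right)
  qed
  finally show ?thesis
    by (simp add: decay_def[abs_def])
qed

lemma integrable_decay_square:
  assumes "a > 0"
  shows "integrable lebesgue (\<lambda>x::'a::euclidean_space. (decay a (real DIM('a)) ((norm x)\<^sup>2))\<^sup>2)"
proof -
  have "(decay a (real DIM('a)) ((norm x)\<^sup>2))\<^sup>2 = (1 + (norm x)\<^sup>2 / a) powr (- real DIM('a))" for x :: 'a
    by (simp add: decay_def power2_eq_square flip: powr_add)
  then show ?thesis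
    using integrable_decay[OF assms, where 'a = 'a] by simp
qed

lemma continuously_differentiable_decay:
  assumes "a > 0"
  shows "continuously_differentiable k (\<lambda>x::'a::euclidean_space. decay a N ((norm x)\<^sup>2))"
proof -
  have "continuously_differentiable k (\<lambda>x::'a. (1 + 1 / a * (norm x)\<^sup>2) powr (- (N / 2)))"
    using assms
    by (intro continuously_differentiable_powr continuously_differentiable_add
        continuously_differentiable_mult continuously_differentiable_norm_square
        continuously_differentiable_const)
      (simp add: add_pos_nonneg)
  then show ?thesis by (simp add: decay_def)
qed

lemma eta1_eq:
  fixes x :: "'a::euclidean_space"
  assumes "DIM('a) \<ge> 2"
  shows "eta1 x = norm x * decay (bubble_scale (real DIM('a))) (real DIM('a)) ((norm x)\<^sup>2)"
proof (cases "DIM('a) = 2")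
  case True
  have "1 + (norm x)\<^sup>2 / 8 > 0"
    by (simp add: add_pos_nonneg)
  then show ?thesis
    using True by (simp add: eta1_def decay_def bubble_scale_def powr_minus_divide)
next
  case False
  then show ?thesis
    by (simp add: eta1_def Let_def decay_def bubble_scale_def powr_minus_divide)
qed

text \<open>With \<open>t = r\<^sup>2\<close>, the non-smooth factor \<open>r = sqrt t\<close> is replaced by \<open>sqrt (t + 1/m)\<close>.\<close>
definition approx :: "real \<Rightarrow> real \<Rightarrow> real \<Rightarrow> real \<Rightarrow> real" where
  "approx a N m t = cutoff (t / m) * (sqrt (t + 1 / m) * decay a N t)"

definition approx_deriv :: "real \<Rightarrow> real \<Rightarrow> real \<Rightarrow> real \<Rightarrow> real" where
  "approx_deriv a N m t = cutoff_deriv (t / m) / m * (sqrt (t + 1 / m) * decay a N t) +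
    cutoff (t / m) * (decay a N t / (2 * sqrt (t + 1 / m)) -
      N * sqrt (t + 1 / m) * decay a N t / (2 * (a + t)))"

lemma approx_has_real_derivative:
  assumes "a > 0" "m > 0" "t \<ge> 0"
  shows "(approx a N m has_real_derivative approx_deriv a N m t) (at t)"
proof -
  have pos: "t + 1 / m > 0"
    using assms by (simp add: add_nonneg_pos)
  have "((\<lambda>t. sqrt (t + 1 / m)) has_real_derivative 1 / (2 * sqrt (t + 1 / m))) (at t)"
    using pos by (auto intro!: derivative_eq_intros simp: field_simps)
  from DERIV_mult[OF cutoff_scaled_has_real_derivative[of m t]
      DERIV_mult[OF this decay_has_real_derivative[OF assms(1,3), of N]]]
  show ?thesis
    unfolding approx_def approx_deriv_def by (rule DERIV_cong) (simp add: algebra_simps)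
qed

text \<open>The left-hand side is the length of the gradient of \<open>approx a N m (r\<^sup>2)\<close>. On the support of the cutoff, where
\<open>t \<le> m\<close>, the derivative of the cutoff contributes a bounded factor because
\<open>sqrt t sqrt (t + 1/m) / m \<le> 2\<close>.\<close>
lemma approx_deriv_bound:
  assumes "a > 0" "m \<ge> 1" "t \<ge> 0" "N \<ge> 0"
  shows "2 * sqrt t * \<bar>approx_deriv a N m t\<bar> \<le> (25 + N * (1 + 1 / a)) * decay a N t"
proof -
  define s r w where "s = sqrt (t + 1 / m)" and "r = sqrt t" and "w = decay a N t"
  have w: "w > 0"
    unfolding w_def using assms by (intro decay_bounds)
  have m: "m > 0" "1 / m \<le> 1"
    using assms by auto
  have s: "s > 0" "s * s = t + 1 / m"
    using assms m by (auto simp: s_def add_nonneg_pos)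
  have r: "0 \<le> r" "r \<le> s"
    using assms by (auto simp: s_def r_def)
  have rs: "r * s \<le> t + 1 / m"
    using mult_right_mono[OF r(2), of s] s by simp
  have 1: "\<bar>2 * r * (cutoff_deriv (t / m) / m * (s * w))\<bar> \<le> 24 * w"
  proof (cases "t / m \<le> 1")
    case True
    have "r * s / m \<le> (t + 1 / m) / m"
      using rs m by (intro divide_right_mono) auto
    also have "\<dots> = t / m + 1 / m * (1 / m)"
      by (simp add: add_divide_distrib)
    also have "\<dots> \<le> 1 + 1 * 1"
      using True m by (intro add_mono mult_mono) auto
    finally have "\<bar>cutoff_deriv (t / m)\<bar> * (r * s / m) \<le> 6 * 2"
      using r s m assms by (intro mult_mono cutoff_bounds) auto
    then have "\<bar>cutoff_deriv (t / m)\<bar> * (r * s / m) * (2 * w) \<le> 6 * 2 * (2 * w)"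
      using w by (intro mult_right_mono) auto
    then show ?thesis
      using r s m w by (simp add: abs_mult mult_ac)
  qed (use w in \<open>simp add: cutoff_eq_0\<close>)
  have 2: "\<bar>2 * r * (w / (2 * s) - N * s * w / (2 * (a + t)))\<bar> \<le> (1 + N * (1 + 1 / a)) * w"
  proof -
    have "r / s \<le> 1"
      using r s by simp
    then have A2: "r / s * w \<le> 1 * w"
      using w by (intro mult_right_mono) auto
    have A1: "0 \<le> r / s * w"
      using w r s by simp
    have "r * s \<le> t + 1"
      using rs m(2) by linarith
    also have "\<dots> \<le> (1 + 1 / a) * (a + t)"
      using assms by (simp add: field_simps)
    finally have "r * s / (a + t) \<le> 1 + 1 / a"
      using assms by (simp add: pos_divide_le_eq add_pos_nonneg)
    then have B2: "N * (r * s / (a + t)) * w \<le> N * (1 + 1 / a) * w"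
      using assms(4) w by (intro mult_right_mono mult_left_mono) auto
    have B1: "0 \<le> N * (r * s / (a + t)) * w"
      using assms r s w by simp
    have "2 * r * (w / (2 * s) - N * s * w / (2 * d)) = r / s * w - N * (r * s / d) * w" for d
      by (simp add: right_diff_distrib mult_ac)
    then show ?thesis
      using A1 A2 B1 B2 distrib_right[of 1 "N * (1 + 1 / a)" w] by (simp only: mult_1)
  qed
  have c: "0 \<le> cutoff (t / m)" "cutoff (t / m) \<le> 1"
    using assms by (auto intro!: cutoff_bounds)
  have 3: "\<bar>cutoff (t / m) * (2 * r * (w / (2 * s) - N * s * w / (2 * (a + t))))\<bar> \<le>
      1 * ((1 + N * (1 + 1 / a)) * w)"
    unfolding abs_mult[of "cutoff _"] using c 2 by (intro mult_mono) auto
  have "2 * r * approx_deriv a N m t = 2 * r * (cutoff_deriv (t / m) / m * (s * w)) +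
      cutoff (t / m) * (2 * r * (w / (2 * s) - N * s * w / (2 * (a + t))))"
    by (simp add: approx_deriv_def s_def w_def algebra_simps)
  also have "\<bar>\<dots>\<bar> \<le> 24 * w + 1 * ((1 + N * (1 + 1 / a)) * w)"
    by (rule order_trans[OF abs_triangle_ineq add_mono[OF 1 3]])
  also have "\<dots> = (25 + N * (1 + 1 / a)) * w"
    by (simp add: algebra_simps)
  finally show ?thesis
    using r by (simp add: abs_mult r_def w_def)
qed

lemma approx_bound:
  assumes "a > 0" "m \<ge> 1" "t \<ge> 0" "N \<ge> 0"
  shows "\<bar>approx a N m t\<bar> \<le> sqrt t + 1"
proof -
  have "sqrt (t + 1 / m) \<le> sqrt t + sqrt (1 / m)"
    using assms by (intro sqrt_add_le_add_sqrt) auto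
  also have "\<dots> \<le> sqrt t + 1"
    using assms by simp
  finally have "sqrt (t + 1 / m) \<le> sqrt t + 1" .
  moreover have "\<bar>cutoff (t / m)\<bar> \<le> 1"
    using cutoff_bounds[of "t / m"] assms by auto
  moreover have "\<bar>decay a N t\<bar> \<le> 1"
    using decay_bounds[OF assms(1,3,4)] by simp
  ultimately have "\<bar>cutoff (t / m)\<bar> * (\<bar>sqrt (t + 1 / m)\<bar> * \<bar>decay a N t\<bar>) \<le> 1 * ((sqrt t + 1) * 1)"
    using assms by (intro mult_mono) auto
  then show ?thesis
    by (simp add: approx_def abs_mult)
qed

lemma approx_tendsto:
  "(\<lambda>n. approx a N (real (Suc n)) t) \<longlonglongrightarrow> sqrt t * decay a N t"
proof -
  have "(\<lambda>n. approx a N (real (Suc n)) t) \<longlonglongrightarrow> 1 * (sqrt (t + 0) * decay a N t)"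
    unfolding approx_def by (intro tendsto_intros cutoff_tendsto_1 inverse_Suc_tendsto_0)
  then show ?thesis by simp
qed

lemma approx_deriv_tendsto:
  assumes "a > 0" "t > 0"
  shows "(\<lambda>n. approx_deriv a N (real (Suc n)) t) \<longlonglongrightarrow>
    decay a N t / (2 * sqrt t) - N * sqrt t * decay a N t / (2 * (a + t))"
proof -
  have nz: "2 * sqrt (t + 0) \<noteq> 0" "2 * (a + t) \<noteq> 0"
    using assms by auto
  have "(\<lambda>n. approx_deriv a N (real (Suc n)) t) \<longlonglongrightarrow> 0 * (sqrt (t + 0) * decay a N t) +
      1 * (decay a N t / (2 * sqrt (t + 0)) - N * sqrt (t + 0) * decay a N t / (2 * (a + t)))"
    unfolding approx_deriv_def
    by (intro tendsto_intros cutoff_tendsto_1 cutoff_deriv_tendsto_0 inverse_Suc_tendsto_0 nz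
        less_imp_le assms)
  then show ?thesis by simp
qed

text \<open>A cutoff reduces this to the case of compact support. Its derivative enters only through
\<open>\<chi>' (t/n) t/n\<close>, which is bounded and tends to zero pointwise, so integrability of \<open>p\<close> itself
suffices.\<close>
lemma integral_divergence_radial_field_decaying:
  fixes p :: "'a::euclidean_space \<Rightarrow> real"
  assumes p: "continuously_differentiable (Suc 0) p" and ip: "integrable lebesgue p"
    and idiv: "integrable lebesgue (\<lambda>x. real DIM('a) * p x + gradient p x \<bullet> x)"
  shows "(LINT x|lebesgue. real DIM('a) * p x + gradient p x \<bullet> x) = 0"
proof -
  define c where "c n x = cutoff ((norm x)\<^sup>2 / real (Suc n))" for n and x :: 'a
  define q where "q n x = c n x * p x" for n x
  have c: "continuously_differentiable (Suc 0) (c n)" for n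
    unfolding c_def using cutoff_radial(1)[of "real (Suc n)", where 'a = 'a] by simp
  have q: "continuously_differentiable (Suc 0) (q n)" for n
    unfolding q_def using c p by (rule continuously_differentiable_mult)
  have out: "\<forall>x. real (Suc n) < norm x \<longrightarrow> q n x = 0" for n
    using cutoff_radial(2)[of "real (Suc n)", where 'a = 'a] by (simp add: q_def c_def)
  have div_q: "real DIM('a) * q n x + gradient (q n) x \<bullet> x =
      c n x * (real DIM('a) * p x + gradient p x \<bullet> x) +
      2 * (cutoff_deriv ((norm x)\<^sup>2 / real (Suc n)) * ((norm x)\<^sup>2 / real (Suc n))) * p x" for n x
  proof -
    note d = continuously_differentiable_has_derivative[OF c, of n x]
      continuously_differentiable_has_derivative[OF p, of x]
    have "gradient (q n) x \<bullet> x = c n x * (gradient p x \<bullet> x) + (gradient (c n) x \<bullet> x) * p x"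
      unfolding q_def gradient_inner[OF has_derivative_mult[OF d]] gradient_inner[OF d(1)]
        gradient_inner[OF d(2)] by simp
    moreover have "gradient (c n) x =
        (2 * (cutoff_deriv ((norm x)\<^sup>2 / real (Suc n)) / real (Suc n))) *\<^sub>R x"
      unfolding c_def by (rule gradient_radial[OF cutoff_scaled_has_real_derivative])
    ultimately show ?thesis
      by (simp add: q_def power2_norm_eq_inner algebra_simps)
  qed
  have "(\<lambda>n. LINT x|lebesgue. real DIM('a) * q n x + gradient (q n) x \<bullet> x) \<longlonglongrightarrow>
      (LINT x|lebesgue. real DIM('a) * p x + gradient p x \<bullet> x)"
  proof (rule integral_dominated_convergence)
    show "integrable lebesgue (\<lambda>x. \<bar>real DIM('a) * p x + gradient p x \<bullet> x\<bar> + 12 * \<bar>p x\<bar>)"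
      by (rule Bochner_Integration.integrable_add[OF integrable_abs[OF idiv]
            integrable_mult_right[OF integrable_abs[OF ip]]])
    show "(\<lambda>x. real DIM('a) * p x + gradient p x \<bullet> x) \<in> borel_measurable lebesgue"
      using idiv by (rule borel_measurable_integrable)
    show "(\<lambda>x. real DIM('a) * q n x + gradient (q n) x \<bullet> x) \<in> borel_measurable lebesgue" for n
      using integral_divergence_radial_field_eq_0(1)[OF q out] by (rule borel_measurable_integrable)
    show "AE x in lebesgue. (\<lambda>n. real DIM('a) * q n x + gradient (q n) x \<bullet> x) \<longlonglongrightarrow>
        real DIM('a) * p x + gradient p x \<bullet> x"
    proof (intro AE_I2)
      fix x :: 'a
      have "(\<lambda>n. (norm x)\<^sup>2 * (cutoff_deriv ((norm x)\<^sup>2 / real (Suc n)) / real (Suc n))) \<longlonglongrightarrow> (norm x)\<^sup>2 * 0"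
        by (intro tendsto_intros cutoff_deriv_tendsto_0) simp
      then have "(\<lambda>n. cutoff_deriv ((norm x)\<^sup>2 / real (Suc n)) * ((norm x)\<^sup>2 / real (Suc n))) \<longlonglongrightarrow> 0"
        by (simp add: mult.commute)
      then have "(\<lambda>n. c n x * (real DIM('a) * p x + gradient p x \<bullet> x) +
          2 * (cutoff_deriv ((norm x)\<^sup>2 / real (Suc n)) * ((norm x)\<^sup>2 / real (Suc n))) * p x) \<longlonglongrightarrow>
          1 * (real DIM('a) * p x + gradient p x \<bullet> x) + 2 * 0 * p x"
        unfolding c_def by (intro tendsto_intros cutoff_tendsto_1)
      then show "(\<lambda>n. real DIM('a) * q n x + gradient (q n) x \<bullet> x) \<longlonglongrightarrow>
          real DIM('a) * p x + gradient p x \<bullet> x"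
        by (simp only: div_q) simp
    qed
    show "AE x in lebesgue. norm (real DIM('a) * q n x + gradient (q n) x \<bullet> x) \<le>
        \<bar>real DIM('a) * p x + gradient p x \<bullet> x\<bar> + 12 * \<bar>p x\<bar>" for n
    proof (intro AE_I2)
      fix x :: 'a
      let ?D = "real DIM('a) * p x + gradient p x \<bullet> x"
      let ?c = "cutoff_deriv ((norm x)\<^sup>2 / real (Suc n)) * ((norm x)\<^sup>2 / real (Suc n))"
      have "\<bar>c n x\<bar> * \<bar>?D\<bar> \<le> 1 * \<bar>?D\<bar>"
        using cutoff_bounds[of "(norm x)\<^sup>2 / real (Suc n)"]
        by (intro mult_right_mono) (auto simp: c_def)
      moreover have "\<bar>?c\<bar> * \<bar>p x\<bar> \<le> 6 * \<bar>p x\<bar>"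
        by (intro mult_right_mono cutoff_deriv_scaled_bound) auto
      ultimately have "\<bar>c n x * ?D\<bar> + \<bar>2 * ?c * p x\<bar> \<le> \<bar>?D\<bar> + 12 * \<bar>p x\<bar>"
        unfolding abs_mult by simp
      then show "norm (real DIM('a) * q n x + gradient (q n) x \<bullet> x) \<le> \<bar>?D\<bar> + 12 * \<bar>p x\<bar>"
        unfolding div_q real_norm_def using abs_triangle_ineq order_trans by blast
    qed
  qed
  then show ?thesis
    using integral_divergence_radial_field_eq_0(2)[OF q out] LIMSEQ_unique[OF _ tendsto_const] by simp
qed

text \<open>The pointwise gradient of the minimiser away from the origin; at the origin its value is \<open>0\<close>.\<close>
definition eta_grad :: "real \<Rightarrow> 'a::euclidean_space \<Rightarrow> 'a" where
  "eta_grad a x = (decay a (real DIM('a)) ((norm x)\<^sup>2) *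
    (1 / norm x - real DIM('a) * norm x / (a + (norm x)\<^sup>2))) *\<^sub>R x"

lemma approx_field:
  fixes a m :: real
  assumes "a > 0" "m \<ge> 1"
  defines "\<phi> \<equiv> \<lambda>x::'a::euclidean_space. approx a (real DIM('a)) m ((norm x)\<^sup>2)"
  shows "test_function \<phi>"
    and "gradient \<phi> x = (2 * approx_deriv a (real DIM('a)) m ((norm x)\<^sup>2)) *\<^sub>R x"
proof -
  have "continuously_differentiable k (\<lambda>x::'a. cutoff ((norm x)\<^sup>2 / m) *
      (((norm x)\<^sup>2 + 1 / m) powr (1 / 2) * decay a (real DIM('a)) ((norm x)\<^sup>2)))" for k
    using assms(1,2)
    by (intro continuously_differentiable_mult cutoff_radial continuously_differentiable_powr
        continuously_differentiable_add continuously_differentiable_norm_square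
        continuously_differentiable_const continuously_differentiable_decay)
      (auto intro: add_nonneg_pos)
  then have "continuously_differentiable k \<phi>" for k
    using assms(2) by (simp add: \<phi>_def approx_def powr_half_sqrt)
  moreover have "\<forall>x. m < norm x \<longrightarrow> \<phi> x = 0"
    using cutoff_radial(2)[OF assms(2), where 'a = 'a] by (simp add: \<phi>_def approx_def)
  ultimately show "test_function \<phi>"
    unfolding test_function_iff by blast
  show "gradient \<phi> x = (2 * approx_deriv a (real DIM('a)) m ((norm x)\<^sup>2)) *\<^sub>R x"
    unfolding \<phi>_def using assms(1,2) by (intro gradient_radial approx_has_real_derivative) auto
qed

section \<open>The minimiser\<close>

context
  fixes a N :: real and \<phi> :: "nat \<Rightarrow> 'a::euclidean_space \<Rightarrow> real" and C :: real and \<eta> w p :: "'a \<Rightarrow> real"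
  assumes a: "a > 0"
  defines "N \<equiv> real DIM('a)"
  defines "\<phi> \<equiv> \<lambda>n x. approx a N (real (Suc n)) ((norm x)\<^sup>2)"
  defines "C \<equiv> 25 + N * (1 + 1 / a)"
  defines "w \<equiv> \<lambda>x. decay a N ((norm x)\<^sup>2)"
  defines "\<eta> \<equiv> \<lambda>x. norm x * w x"
  defines "p \<equiv> \<lambda>x. (w x)\<^sup>2 * (1 - N * (norm x)\<^sup>2 / (a + (norm x)\<^sup>2))"
begin

lemma eta_approx_test: "test_function (\<phi> n)"
  unfolding \<phi>_def N_def using approx_field(1)[OF a, of "real (Suc n)", where 'a = 'a] by simp

lemma eta_approx_smooth: "continuously_differentiable k (\<phi> n)"
  using eta_approx_test by (simp add: test_function_def)

lemma eta_approx_continuous: "continuous_on UNIV (\<phi> n)" "continuous_on UNIV (gradient (\<phi> n))"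
  using eta_approx_smooth continuously_differentiable_imp_continuous_on continuous_on_gradient
  by blast+

lemma w_continuous: "continuous_on UNIV w"
  unfolding w_def
  by (rule continuously_differentiable_imp_continuous_on[OF continuously_differentiable_decay[OF a]])

lemma eta_continuous: "continuous_on UNIV \<eta>"
  unfolding \<eta>_def by (intro continuous_intros w_continuous)

lemma w_pos: "w x > 0"
  unfolding w_def using a by (intro decay_bounds) (auto simp: N_def)

lemma eta_approx_tendsto: "(\<lambda>n. \<phi> n x) \<longlonglongrightarrow> \<eta> x"
  using approx_tendsto[of a N "(norm x)\<^sup>2"] by (simp add: \<phi>_def \<eta>_def w_def)

lemma eta_approx_bound: "\<bar>\<phi> n x\<bar> \<le> norm x + 1"
  using approx_bound[OF a, of "real (Suc n)" "(norm x)\<^sup>2" N] by (simp add: \<phi>_def N_def)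

lemma eta_bound: "\<bar>\<eta> x\<bar> \<le> norm x + 1"
  by (rule LIMSEQ_le_const2[OF tendsto_rabs[OF eta_approx_tendsto]]) (use eta_approx_bound in blast)

lemma eta_approx_gradient_tendsto: "(\<lambda>n. gradient (\<phi> n) x) \<longlonglongrightarrow> eta_grad a x"
proof (cases "x = 0")
  case True
  then show ?thesis
    using approx_field(2)[OF a, where 'a = 'a] by (simp add: \<phi>_def N_def eta_grad_def)
next
  case False
  have half: "2 * (A / (2 * r) - B / (2 * d)) = A / r - B / d" for A B r d :: real
    by (simp add: right_diff_distrib)
  have "(\<lambda>n. (2 * approx_deriv a N (real (Suc n)) ((norm x)\<^sup>2)) *\<^sub>R x) \<longlonglongrightarrow>
      (2 * (w x / (2 * sqrt ((norm x)\<^sup>2)) -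
        N * sqrt ((norm x)\<^sup>2) * w x / (2 * (a + (norm x)\<^sup>2)))) *\<^sub>R x"
    unfolding w_def using False by (intro tendsto_intros approx_deriv_tendsto a) simp
  also have "(\<lambda>n. (2 * approx_deriv a N (real (Suc n)) ((norm x)\<^sup>2)) *\<^sub>R x) = (\<lambda>n. gradient (\<phi> n) x)"
    using approx_field(2)[OF a, where 'a = 'a] by (simp add: \<phi>_def N_def)
  also have "2 * (w x / (2 * sqrt ((norm x)\<^sup>2)) -
        N * sqrt ((norm x)\<^sup>2) * w x / (2 * (a + (norm x)\<^sup>2))) =
      w x * (1 / norm x - N * norm x / (a + (norm x)\<^sup>2))"
    unfolding half by (simp add: right_diff_distrib mult.commute mult.left_commute)
  finally show ?thesis
    by (simp add: eta_grad_def w_def N_def)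
qed

lemma eta_approx_gradient_bound: "norm (gradient (\<phi> n) x) \<le> C * w x"
proof -
  have "norm (gradient (\<phi> n) x) = 2 * sqrt ((norm x)\<^sup>2) * \<bar>approx_deriv a N (real (Suc n)) ((norm x)\<^sup>2)\<bar>"
    using approx_field(2)[OF a, where 'a = 'a] by (simp add: \<phi>_def N_def abs_mult)
  also have "\<dots> \<le> C * w x"
    unfolding C_def w_def using a by (intro approx_deriv_bound) (auto simp: N_def)
  finally show ?thesis .
qed

lemma eta_grad_bound: "norm (eta_grad a x) \<le> C * w x"
  by (rule LIMSEQ_le_const2[OF tendsto_norm[OF eta_approx_gradient_tendsto]])
    (use eta_approx_gradient_bound in blast)

lemma eta_grad_measurable: "(eta_grad a :: 'a \<Rightarrow> 'a) \<in> borel_measurable lebesgue"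
proof (rule borel_measurable_LIMSEQ_metric)
  show "gradient (\<phi> n) \<in> borel_measurable lebesgue" for n
    using eta_approx_continuous(2) by (rule borel_measurable_lebesgue_continuous)
qed (rule eta_approx_gradient_tendsto)

lemma w_square_integrable: "integrable lebesgue (\<lambda>x. (w x)\<^sup>2)"
  unfolding w_def N_def by (rule integrable_decay_square[OF a])

lemma eta_grad_square_integrable: "square_integrable (eta_grad a :: 'a \<Rightarrow> 'a)"
  unfolding square_integrable_def
proof
  show "integrable lebesgue (\<lambda>x::'a. (norm (eta_grad a x))\<^sup>2)"
  proof (rule Bochner_Integration.integrable_bound[OF integrable_mult_right[OF w_square_integrable, of "C\<^sup>2"]])
    show "(\<lambda>x::'a. (norm (eta_grad a x))\<^sup>2) \<in> borel_measurable lebesgue"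
      using eta_grad_measurable by (intro borel_measurable_power measurable_compose[OF _ borel_measurable_norm]) auto
    show "AE x::'a in lebesgue. norm ((norm (eta_grad a x))\<^sup>2) \<le> norm (C\<^sup>2 * (w x)\<^sup>2)"
      using power_mono[OF eta_grad_bound norm_ge_zero, of _ 2] by (simp add: power_mult_distrib)
  qed
qed (rule eta_grad_measurable)

text \<open>Both sides of the integration by parts formula for the approximations pass to the limit by dominated
convergence.\<close>
lemma eta_has_weak_gradient: "has_weak_gradient \<eta> (eta_grad a)"
  unfolding has_weak_gradient_def
proof (intro conjI allI impI ballI)
  show "locally_integrable \<eta>"
    using eta_continuous by (rule locally_integrable_continuous)
  show "locally_integrable (eta_grad a :: 'a \<Rightarrow> 'a)"
    unfolding locally_integrable_def
  proof (intro allI impI)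
    fix K :: "'a set" assume K: "compact K"
    have KL: "K \<in> sets lebesgue"
      using borel_compact[OF K] by simp
    from K have "set_integrable lebesgue K (\<lambda>x. C * w x)"
      using locally_integrable_continuous[OF continuous_on_mult_left[OF w_continuous, of C]]
      by (simp add: locally_integrable_def)
    then show "set_integrable lebesgue K (eta_grad a)"
    proof (rule set_integrable_bound)
      show "set_borel_measurable lebesgue K (eta_grad a)"
        unfolding set_borel_measurable_def
        by (intro borel_measurable_scaleR borel_measurable_indicator eta_grad_measurable KL)
      show "AE x in lebesgue. x \<in> K \<longrightarrow> norm (eta_grad a x) \<le> norm (C * w x)"
        using eta_grad_bound by (intro AE_I2 impI) (auto intro: order_trans[OF _ abs_ge_self])
    qed
  qed
  fix \<psi> :: "'a \<Rightarrow> real" and b :: 'a assume \<psi>: "test_function \<psi>" and b: "b \<in> Basis"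
  from \<psi> obtain R where R: "\<forall>x. R < norm x \<longrightarrow> \<psi> x = 0"
    and smooth: "\<And>k. continuously_differentiable k \<psi>"
    by (auto simp: test_function_iff)
  note c = continuously_differentiable_imp_continuous_on[OF smooth] continuous_on_gradient[OF smooth]
  have parts: "(LINT x|lebesgue. \<phi> n x * (gradient \<psi> x \<bullet> b)) = - (LINT x|lebesgue. \<psi> x * (gradient (\<phi> n) x \<bullet> b))"
    for n
    by (rule integration_by_parts[OF eta_approx_smooth smooth R b])
  have "(\<lambda>n. LINT x|lebesgue. \<phi> n x * (gradient \<psi> x \<bullet> b)) \<longlonglongrightarrow> (LINT x|lebesgue. \<eta> x * (gradient \<psi> x \<bullet> b))"
  proof (rule integral_dominated_convergence[where w = "\<lambda>x. (norm x + 1) * \<bar>gradient \<psi> x \<bullet> b\<bar>"])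
    show "integrable lebesgue (\<lambda>x. (norm x + 1) * \<bar>gradient \<psi> x \<bullet> b\<bar>)"
      using gradient_eq_0_outside[OF R]
      by (auto intro!: integrable_continuous_bounded_support[where R = R] continuous_intros c)
    show "(\<lambda>x. \<eta> x * (gradient \<psi> x \<bullet> b)) \<in> borel_measurable lebesgue"
      by (intro borel_measurable_lebesgue_continuous continuous_intros c eta_continuous)
    show "(\<lambda>x. \<phi> n x * (gradient \<psi> x \<bullet> b)) \<in> borel_measurable lebesgue" for n
      by (intro borel_measurable_lebesgue_continuous continuous_intros c eta_approx_continuous)
    show "AE x in lebesgue. (\<lambda>n. \<phi> n x * (gradient \<psi> x \<bullet> b)) \<longlonglongrightarrow> \<eta> x * (gradient \<psi> x \<bullet> b)"
      by (intro AE_I2 tendsto_intros eta_approx_tendsto)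
    show "AE x in lebesgue. norm (\<phi> n x * (gradient \<psi> x \<bullet> b)) \<le> (norm x + 1) * \<bar>gradient \<psi> x \<bullet> b\<bar>" for n
      using eta_approx_bound by (intro AE_I2) (simp add: abs_mult mult_right_mono)
  qed
  moreover have "(\<lambda>n. - (LINT x|lebesgue. \<psi> x * (gradient (\<phi> n) x \<bullet> b))) \<longlonglongrightarrow>
      - (LINT x|lebesgue. \<psi> x * (eta_grad a x \<bullet> b))"
  proof (intro tendsto_minus integral_dominated_convergence[where w = "\<lambda>x. \<bar>\<psi> x\<bar> * (C * w x)"])
    show "integrable lebesgue (\<lambda>x. \<bar>\<psi> x\<bar> * (C * w x))"
      using R by (auto intro!: integrable_continuous_bounded_support[where R = R] continuous_intros c w_continuous)
    show "(\<lambda>x. \<psi> x * (eta_grad a x \<bullet> b)) \<in> borel_measurable lebesgue"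
      using eta_grad_measurable borel_measurable_lebesgue_continuous[OF c(1)]
      by (intro borel_measurable_times borel_measurable_inner) auto
    show "(\<lambda>x. \<psi> x * (gradient (\<phi> n) x \<bullet> b)) \<in> borel_measurable lebesgue" for n
      by (intro borel_measurable_lebesgue_continuous continuous_intros c eta_approx_continuous)
    show "AE x in lebesgue. (\<lambda>n. \<psi> x * (gradient (\<phi> n) x \<bullet> b)) \<longlonglongrightarrow> \<psi> x * (eta_grad a x \<bullet> b)"
      by (intro AE_I2 tendsto_intros eta_approx_gradient_tendsto)
    show "AE x in lebesgue. norm (\<psi> x * (gradient (\<phi> n) x \<bullet> b)) \<le> \<bar>\<psi> x\<bar> * (C * w x)" for n
      using Basis_le_norm[OF b] eta_approx_gradient_bound
      by (intro AE_I2) (auto simp: abs_mult intro!: mult_left_mono intro: order_trans)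
  qed
  ultimately show "(LINT x|lebesgue. \<eta> x * (gradient \<psi> x \<bullet> b)) = - (LINT x|lebesgue. \<psi> x * (eta_grad a x \<bullet> b))"
    unfolding parts by (rule LIMSEQ_unique)
qed

lemma weak_gradient_eta_AE: "AE x in lebesgue. weak_gradient \<eta> x = eta_grad a x"
proof -
  have "has_weak_gradient \<eta> (weak_gradient \<eta>)"
    unfolding weak_gradient_def
    by (rule someI[of "has_weak_gradient \<eta>", OF eta_has_weak_gradient])
  then show ?thesis
    using eta_has_weak_gradient by (rule weak_gradient_unique_AE)
qed

lemma weak_gradient_eta_measurable: "weak_gradient \<eta> \<in> borel_measurable lebesgue"
proof -
  have "has_weak_gradient \<eta> (weak_gradient \<eta>)"
    unfolding weak_gradient_def
    by (rule someI[of "has_weak_gradient \<eta>", OF eta_has_weak_gradient])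
  then show ?thesis
    by (simp add: has_weak_gradient_def locally_integrable_imp_measurable)
qed

lemma eta_approx_gradient_L2:
  "(\<lambda>n. LINT x|lebesgue. (norm (gradient (\<phi> n) x - eta_grad a x))\<^sup>2) \<longlonglongrightarrow> 0"
proof -
  have "(\<lambda>n. LINT x|lebesgue. (norm (gradient (\<phi> n) x - eta_grad a x))\<^sup>2) \<longlonglongrightarrow> (LINT x::'a|lebesgue. 0)"
  proof (rule integral_dominated_convergence)
    show "integrable lebesgue (\<lambda>x. (2 * C)\<^sup>2 * (w x)\<^sup>2)"
      by (intro integrable_mult_right w_square_integrable)
    show "(\<lambda>x. (norm (gradient (\<phi> n) x - eta_grad a x))\<^sup>2) \<in> borel_measurable lebesgue" for n
      using eta_grad_measurable borel_measurable_lebesgue_continuous[OF eta_approx_continuous(2)[of n]]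
      by (intro borel_measurable_power measurable_compose[OF _ borel_measurable_norm] borel_measurable_diff) auto
    show "AE x in lebesgue. (\<lambda>n. (norm (gradient (\<phi> n) x - eta_grad a x))\<^sup>2) \<longlonglongrightarrow> 0"
    proof (intro AE_I2)
      fix x
      have "(\<lambda>n. (norm (gradient (\<phi> n) x - eta_grad a x))\<^sup>2) \<longlonglongrightarrow> (norm (eta_grad a x - eta_grad a x))\<^sup>2"
        by (intro tendsto_intros eta_approx_gradient_tendsto)
      then show "(\<lambda>n. (norm (gradient (\<phi> n) x - eta_grad a x))\<^sup>2) \<longlonglongrightarrow> 0"
        by simp
    qed
    show "AE x in lebesgue. norm ((norm (gradient (\<phi> n) x - eta_grad a x))\<^sup>2) \<le> (2 * C)\<^sup>2 * (w x)\<^sup>2" for n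
    proof (intro AE_I2)
      fix x
      have "norm (gradient (\<phi> n) x - eta_grad a x) \<le> C * w x + C * w x"
        by (intro order_trans[OF norm_triangle_ineq4] add_mono eta_approx_gradient_bound eta_grad_bound)
      then have "(norm (gradient (\<phi> n) x - eta_grad a x))\<^sup>2 \<le> (2 * C * w x)\<^sup>2"
        by (intro power_mono) auto
      then show "norm ((norm (gradient (\<phi> n) x - eta_grad a x))\<^sup>2) \<le> (2 * C)\<^sup>2 * (w x)\<^sup>2"
        by (simp add: power_mult_distrib)
    qed
  qed simp
  then show ?thesis by simp
qed

lemma eta_approx_L1: "compact K \<Longrightarrow> (\<lambda>n. LINT x:K|lebesgue. \<bar>\<phi> n x - \<eta> x\<bar>) \<longlonglongrightarrow> 0"
proof -
  assume K: "compact K"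
  have KL: "K \<in> sets lebesgue"
    using borel_compact[OF K] by simp
  have "(\<lambda>n. LINT x|lebesgue. indicator K x *\<^sub>R \<bar>\<phi> n x - \<eta> x\<bar>) \<longlonglongrightarrow> (LINT x::'a|lebesgue. 0)"
  proof (rule integral_dominated_convergence)
    have "locally_integrable (\<lambda>x::'a. 2 * (norm x + 1))"
      by (intro locally_integrable_continuous continuous_intros)
    then show "integrable lebesgue (\<lambda>x. indicator K x *\<^sub>R (2 * (norm x + 1)))"
      using K by (simp add: locally_integrable_def set_integrable_def)
    show "(\<lambda>x. indicator K x *\<^sub>R \<bar>\<phi> n x - \<eta> x\<bar>) \<in> borel_measurable lebesgue" for n
      by (intro borel_measurable_scaleR borel_measurable_indicator KL
          borel_measurable_lebesgue_continuous continuous_intros eta_approx_continuous eta_continuous)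
    show "AE x in lebesgue. (\<lambda>n. indicator K x *\<^sub>R \<bar>\<phi> n x - \<eta> x\<bar>) \<longlonglongrightarrow> 0"
    proof (intro AE_I2)
      fix x
      have "(\<lambda>n. indicator K x *\<^sub>R \<bar>\<phi> n x - \<eta> x\<bar>) \<longlonglongrightarrow> indicator K x *\<^sub>R \<bar>\<eta> x - \<eta> x\<bar>"
        by (intro tendsto_intros eta_approx_tendsto)
      then show "(\<lambda>n. indicator K x *\<^sub>R \<bar>\<phi> n x - \<eta> x\<bar>) \<longlonglongrightarrow> 0"
        by simp
    qed
    show "AE x in lebesgue. norm (indicator K x *\<^sub>R \<bar>\<phi> n x - \<eta> x\<bar>) \<le> indicator K x *\<^sub>R (2 * (norm x + 1))" for n
    proof (intro AE_I2)
      fix x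
      have "\<bar>\<phi> n x - \<eta> x\<bar> \<le> 2 * (norm x + 1)"
        using abs_triangle_ineq4[of "\<phi> n x" "\<eta> x"] eta_approx_bound[of n x] eta_bound[of x]
        by simp
      then show "norm (indicator K x *\<^sub>R \<bar>\<phi> n x - \<eta> x\<bar>) \<le> indicator K x *\<^sub>R (2 * (norm x + 1))"
        by (simp add: indicator_def)
    qed
  qed simp
  then show ?thesis by (simp add: set_lebesgue_integral_def)
qed

lemma eta_in_D12: "\<eta> \<in> D12"
  unfolding D12_def mem_Collect_eq
proof (intro conjI exI[of _ \<phi>] allI impI)
  show "\<exists>G. has_weak_gradient \<eta> G"
    by (rule exI[of _ "eta_grad a"]) (rule eta_has_weak_gradient)
  have sq: "(\<lambda>x. (norm (g x))\<^sup>2) \<in> borel_measurable lebesgue" if "g \<in> borel_measurable lebesgue" for g :: "'a \<Rightarrow> 'a"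
    using that by (intro borel_measurable_power measurable_compose[OF _ borel_measurable_norm])
  have "integrable lebesgue (\<lambda>x. (norm (weak_gradient \<eta> x))\<^sup>2) \<longleftrightarrow>
      integrable lebesgue (\<lambda>x::'a. (norm (eta_grad a x))\<^sup>2)"
    by (intro integrable_cong_AE sq weak_gradient_eta_measurable eta_grad_measurable
        eventually_mono[OF weak_gradient_eta_AE]) simp
  then show "square_integrable (weak_gradient \<eta>)"
    using eta_grad_square_integrable weak_gradient_eta_measurable by (simp add: square_integrable_def)
  show "test_function (\<phi> n)" for n
    by (rule eta_approx_test)
  show "compact K \<Longrightarrow> (\<lambda>n. LINT x:K|lebesgue. \<bar>\<phi> n x - \<eta> x\<bar>) \<longlonglongrightarrow> 0" for K
    by (rule eta_approx_L1)
  have "(LINT x|lebesgue. (norm (gradient (\<phi> n) x - weak_gradient \<eta> x))\<^sup>2) =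
      (LINT x|lebesgue. (norm (gradient (\<phi> n) x - eta_grad a x))\<^sup>2)" for n
    using borel_measurable_lebesgue_continuous[OF eta_approx_continuous(2)[of n]]
    by (intro integral_cong_AE sq borel_measurable_diff weak_gradient_eta_measurable eta_grad_measurable
        eventually_mono[OF weak_gradient_eta_AE]) simp_all
  then show "(\<lambda>n. LINT x|lebesgue. (norm (gradient (\<phi> n) x - weak_gradient \<eta> x))\<^sup>2) \<longlonglongrightarrow> 0"
    using eta_approx_gradient_L2 by simp
qed

lemma eta_admissible: "\<eta> \<in> admissible"
proof -
  have "(\<lambda>x. \<eta> x / norm x) \<in> borel_measurable lebesgue"
  proof -
    have "w \<in> borel_measurable borel"
      using w_continuous by (rule borel_measurable_continuous_onI)
    then have "(\<lambda>x. \<eta> x / norm x) \<in> borel_measurable borel"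
      unfolding \<eta>_def by measurable
    then show ?thesis
      by (intro measurable_completion) simp
  qed
  moreover have "integrable lebesgue (\<lambda>x. (norm (\<eta> x / norm x))\<^sup>2)"
  proof (rule Bochner_Integration.integrable_bound[OF w_square_integrable])
    show "(\<lambda>x. (norm (\<eta> x / norm x))\<^sup>2) \<in> borel_measurable lebesgue"
      by (intro borel_measurable_power measurable_compose[OF _ borel_measurable_norm]) fact
    show "AE x in lebesgue. norm ((norm (\<eta> x / norm x))\<^sup>2) \<le> norm ((w x)\<^sup>2)"
      by (intro AE_I2) (auto simp: \<eta>_def)
  qed
  ultimately have "\<eta> \<in> L2_inverse_norm"
    by (simp add: L2_inverse_norm_def square_integrable_def)
  moreover have "\<exists>f. AE x in lebesgue. \<eta> x = f (norm x)"
    by (intro exI[of _ "\<lambda>r. r * decay a N (r\<^sup>2)"] AE_I2) (simp add: \<eta>_def w_def)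
  moreover have "\<not> (AE x in lebesgue. \<eta> x = 0)"
  proof
    assume "AE x in lebesgue. \<eta> x = 0"
    then have "AE x::'a in lebesgue. False"
      using AE_lebesgue_nonzero
    proof eventually_elim
      case (elim x)
      then show ?case
        using w_pos[of x] by (simp add: \<eta>_def)
    qed
    then have "emeasure lebesgue (space (lebesgue :: 'a measure)) = 0"
      by (simp add: eventually_False ae_filter_eq_bot_iff)
    then show False by simp
  qed
  ultimately show ?thesis
    using eta_in_D12 by (simp add: admissible_def D_rad_def D12_rad_def)
qed

text \<open>The field \<open>p(x) x\<close> is \<open>\<eta> \<nabla>\<eta> = \<eta>\<^sup>2 F\<close>, extended smoothly across the origin. The last claim is the identity
\<open>div (\<eta> \<nabla>\<eta>) = |\<nabla>\<eta>|\<^sup>2 + \<eta> \<Delta>\<eta>\<close> combined with the Euler equation. In the variable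
\<open>y = r\<^sup>2/(a + r\<^sup>2)\<close>, which ranges over \<open>[0, 1]\<close>, the divergence is the square of the decay factor times a
polynomial.\<close>
lemma eta_flux:
  shows "continuously_differentiable (Suc 0) p"
    and "integrable lebesgue p"
    and "integrable lebesgue (\<lambda>x. N * p x + gradient p x \<bullet> x)"
    and "x \<noteq> 0 \<Longrightarrow> N * p x + gradient p x \<bullet> x = (norm (eta_grad a x))\<^sup>2
      - N * (N + 2) * a / (a + (norm x)\<^sup>2)\<^sup>2 * (\<eta> x)\<^sup>2 + (N - 1) * (w x)\<^sup>2"
proof -
  have "continuously_differentiable (Suc 0) (\<lambda>x::'a. decay a N ((norm x)\<^sup>2) * decay a N ((norm x)\<^sup>2) *
      (1 - N * ((norm x)\<^sup>2 * (1 / (a + (norm x)\<^sup>2)))))"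
    using a
    by (intro continuously_differentiable_mult continuously_differentiable_diff
        continuously_differentiable_decay continuously_differentiable_inverse
        continuously_differentiable_add continuously_differentiable_norm_square
        continuously_differentiable_const) (auto intro: add_pos_nonneg)
  then show p: "continuously_differentiable (Suc 0) p"
    by (simp only: p_def w_def power2_eq_square[of "decay _ _ _"] times_divide_eq_right mult_1_right)
  define y where "y x = (norm x)\<^sup>2 / (a + (norm x)\<^sup>2)" for x :: 'a
  have pos: "a + (norm x)\<^sup>2 > 0" for x :: 'a
    using a by (simp add: add_pos_nonneg)
  have y: "0 \<le> y x" "y x \<le> 1" for x
    using pos[of x] a by (simp_all add: y_def)
  have y2: "0 \<le> (y x)\<^sup>2" "(y x)\<^sup>2 \<le> 1" for x
    using y[of x] by (simp_all add: power_le_one)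
  have N: "N \<ge> 0"
    by (simp add: N_def)
  have p_eq: "p x = (w x)\<^sup>2 * (1 - N * y x)" for x
    by (simp add: p_def y_def)
  have div_eq: "N * p x + gradient p x \<bullet> x =
      (w x)\<^sup>2 * (N - (N\<^sup>2 + 4 * N) * y x + (2 * N\<^sup>2 + 2 * N) * (y x)\<^sup>2)" for x
  proof -
    define t where "t = (norm x)\<^sup>2"
    have t: "t \<ge> 0" "a + t > 0"
      using pos[of x] by (simp_all add: t_def)
    define d where "d = - (N / 2) * decay a N t / (a + t)"
    have "((\<lambda>t. 1 - N * t / (a + t)) has_real_derivative - N * a / (a + t)\<^sup>2) (at t)"
      using t by (auto intro!: derivative_eq_intros simp: power2_eq_square field_simps)
    from DERIV_mult[OF DERIV_power[OF decay_has_real_derivative[OF a t(1), of N], of 2] this]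
    have "((\<lambda>t. (decay a N t)\<^sup>2 * (1 - N * t / (a + t))) has_real_derivative
        2 * d * decay a N t * (1 - N * t / (a + t)) + (- N * a / (a + t)\<^sup>2) * (decay a N t)\<^sup>2) (at t)"
      by (rule DERIV_cong) (simp add: d_def)
    from gradient_radial[OF this[unfolded t_def]]
    have "gradient p x \<bullet> x = 2 * (2 * d * decay a N t * (1 - N * t / (a + t)) +
        (- N * a / (a + t)\<^sup>2) * (decay a N t)\<^sup>2) * t"
      by (simp add: p_def w_def t_def power2_norm_eq_inner)
    moreover have "N * p x + 2 * (2 * d * decay a N t * (1 - N * t / (a + t)) +
        (- N * a / (a + t)\<^sup>2) * (decay a N t)\<^sup>2) * t =
      (w x)\<^sup>2 * (N - (N\<^sup>2 + 4 * N) * y x + (2 * N\<^sup>2 + 2 * N) * (y x)\<^sup>2)"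
    proof -
      define z where "z = 1 / (a + t)"
      have z: "z * (a + t) = 1"
        using t by (simp add: z_def)
      define u where "u = decay a N t"
      have "N * (u\<^sup>2 * (1 - N * (t * z))) + 2 * (2 * (- (N / 2) * u * z) * u * (1 - N * (t * z)) +
          (- N * a * z\<^sup>2) * u\<^sup>2) * t =
        u\<^sup>2 * (N - (N\<^sup>2 + 4 * N) * (t * z) + (2 * N\<^sup>2 + 2 * N) * (t * z)\<^sup>2)"
        using z by algebra
      then show ?thesis
        by (simp add: p_def w_def y_def d_def z_def u_def t_def power_divide)
    qed
    ultimately show ?thesis
      by simp
  qed
  have bound: "integrable lebesgue f"
    if "continuous_on UNIV f" "\<And>x. \<bar>f x\<bar> \<le> c * (w x)\<^sup>2" for f c
    using that(2)
    by (intro Bochner_Integration.integrable_bound[OF integrable_mult_right[OF w_square_integrable, of c]]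
        borel_measurable_lebesgue_continuous that(1) AE_I2)
      (auto intro: order_trans[OF _ abs_ge_self])
  show "integrable lebesgue p"
  proof (rule bound)
    show "continuous_on UNIV p"
      using p by (rule continuously_differentiable_imp_continuous_on)
    fix x
    have "0 \<le> N * y x" "N * y x \<le> N"
      using y[of x] N by (auto intro: mult_left_le)
    then have "\<bar>1 - N * y x\<bar> \<le> 1 + N"
      using N by linarith
    then show "\<bar>p x\<bar> \<le> (1 + N) * (w x)\<^sup>2"
      by (simp add: p_eq abs_mult mult.commute[of _ "(w x)\<^sup>2"] mult_left_mono)
  qed
  show "integrable lebesgue (\<lambda>x. N * p x + gradient p x \<bullet> x)"
  proof (rule bound)
    show "continuous_on UNIV (\<lambda>x. N * p x + gradient p x \<bullet> x)"
      by (intro continuous_intros continuous_on_gradient[OF p]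
          continuously_differentiable_imp_continuous_on[OF p])
    fix x
    have "0 \<le> (N\<^sup>2 + 4 * N) * y x" "(N\<^sup>2 + 4 * N) * y x \<le> N\<^sup>2 + 4 * N"
      "0 \<le> (2 * N\<^sup>2 + 2 * N) * (y x)\<^sup>2" "(2 * N\<^sup>2 + 2 * N) * (y x)\<^sup>2 \<le> 2 * N\<^sup>2 + 2 * N"
      using y[of x] y2[of x] N by (auto intro: mult_left_le)
    then have "\<bar>N - (N\<^sup>2 + 4 * N) * y x + (2 * N\<^sup>2 + 2 * N) * (y x)\<^sup>2\<bar> \<le> N + (N\<^sup>2 + 4 * N) + (2 * N\<^sup>2 + 2 * N)"
      using N by linarith
    then show "\<bar>N * p x + gradient p x \<bullet> x\<bar> \<le> (N + (N\<^sup>2 + 4 * N) + (2 * N\<^sup>2 + 2 * N)) * (w x)\<^sup>2"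
      unfolding div_eq by (simp add: abs_mult mult.commute[of _ "(w x)\<^sup>2"] mult_left_mono)
  qed
  show "N * p x + gradient p x \<bullet> x = (norm (eta_grad a x))\<^sup>2
      - N * (N + 2) * a / (a + (norm x)\<^sup>2)\<^sup>2 * (\<eta> x)\<^sup>2 + (N - 1) * (w x)\<^sup>2" if "x \<noteq> 0"
  proof -
    define z where "z = 1 / (a + (norm x)\<^sup>2)"
    have z: "z * (a + (norm x)\<^sup>2) = 1"
      using pos[of x] by (simp add: z_def)
    have "norm (eta_grad a x) = \<bar>w x * (1 - N * y x)\<bar>"
    proof -
      have "norm (eta_grad a x) = \<bar>w x * (1 / norm x - N * norm x / (a + (norm x)\<^sup>2)) * norm x\<bar>"
        by (simp add: eta_grad_def w_def N_def abs_mult)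
      also have "w x * (1 / norm x - N * norm x / (a + (norm x)\<^sup>2)) * norm x = w x * (1 - N * y x)"
        using that by (simp add: y_def left_diff_distrib power2_eq_square)
      finally show ?thesis .
    qed
    then have "(norm (eta_grad a x))\<^sup>2 = (w x * (1 - N * y x))\<^sup>2"
      by simp
    moreover have "y x = (norm x)\<^sup>2 * z"
      by (simp add: y_def z_def)
    moreover have "N * (N + 2) * a / (a + (norm x)\<^sup>2)\<^sup>2 * (\<eta> x)\<^sup>2 = N * (N + 2) * a * z\<^sup>2 * (norm x * w x)\<^sup>2"
      by (simp add: z_def \<eta>_def power_divide)
    ultimately show ?thesis
      unfolding div_eq using z by algebra
  qed
qed

text \<open>Integrating the identity of the preceding lemma: the divergence contributes nothing.\<close>
lemma eta_energy:
  "(LINT x|lebesgue. (norm (weak_gradient \<eta> x))\<^sup>2 - N * (N + 2) * a / (a + (norm x)\<^sup>2)\<^sup>2 * (\<eta> x)\<^sup>2)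
    = - (N - 1) * (LINT x|lebesgue. (\<eta> x)\<^sup>2 / (norm x)\<^sup>2)"
proof -
  note flux = eta_flux
  have wm: "w \<in> borel_measurable lebesgue"
    using w_continuous by (rule borel_measurable_lebesgue_continuous)
  have cont: "continuous_on UNIV (\<lambda>x::'a. N * (N + 2) * a / (a + (norm x)\<^sup>2)\<^sup>2)"
  proof -
    have "a + (norm x)\<^sup>2 \<noteq> 0" for x :: 'a
      using a add_pos_nonneg[of a "(norm x)\<^sup>2"] by simp
    then show ?thesis
      by (intro continuous_intros) auto
  qed
  have "(LINT x|lebesgue. (norm (weak_gradient \<eta> x))\<^sup>2 - N * (N + 2) * a / (a + (norm x)\<^sup>2)\<^sup>2 * (\<eta> x)\<^sup>2) =
      (LINT x|lebesgue. (N * p x + gradient p x \<bullet> x) - (N - 1) * (w x)\<^sup>2)"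
  proof (rule integral_cong_AE)
    show "(\<lambda>x. (norm (weak_gradient \<eta> x))\<^sup>2 - N * (N + 2) * a / (a + (norm x)\<^sup>2)\<^sup>2 * (\<eta> x)\<^sup>2)
        \<in> borel_measurable lebesgue"
      by (intro borel_measurable_diff borel_measurable_power borel_measurable_times
          measurable_compose[OF weak_gradient_eta_measurable borel_measurable_norm]
          borel_measurable_lebesgue_continuous[OF cont]
          borel_measurable_lebesgue_continuous[OF eta_continuous])
    show "(\<lambda>x. N * p x + gradient p x \<bullet> x - (N - 1) * (w x)\<^sup>2) \<in> borel_measurable lebesgue"
      using flux(3) wm by (intro borel_measurable_diff borel_measurable_times borel_measurable_power) auto
    show "AE x in lebesgue. (norm (weak_gradient \<eta> x))\<^sup>2 - N * (N + 2) * a / (a + (norm x)\<^sup>2)\<^sup>2 * (\<eta> x)\<^sup>2 =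
        (N * p x + gradient p x \<bullet> x) - (N - 1) * (w x)\<^sup>2"
      using weak_gradient_eta_AE AE_lebesgue_nonzero
    proof eventually_elim
      case (elim x)
      then show ?case
        using flux(4)[of x] by simp
    qed
  qed
  also have "\<dots> = - (N - 1) * (LINT x|lebesgue. (w x)\<^sup>2)"
    using integral_divergence_radial_field_decaying[OF flux(1,2) flux(3)[unfolded N_def], folded N_def]
    by (subst Bochner_Integration.integral_diff[OF flux(3) integrable_mult_right[OF w_square_integrable]])
      (simp only: integral_mult_right_zero)
  also have "(LINT x|lebesgue. (w x)\<^sup>2) = (LINT x|lebesgue. (\<eta> x)\<^sup>2 / (norm x)\<^sup>2)"
  proof (rule integral_cong_AE)
    show "(\<lambda>x. (w x)\<^sup>2) \<in> borel_measurable lebesgue"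
      using wm by (rule borel_measurable_power)
    show "(\<lambda>x. (\<eta> x)\<^sup>2 / (norm x)\<^sup>2) \<in> borel_measurable lebesgue"
      using integrable_inverse_square_weight[of \<eta>] eta_admissible by (auto simp: admissible_def)
    show "AE x in lebesgue. (w x)\<^sup>2 = (\<eta> x)\<^sup>2 / (norm x)\<^sup>2"
      using AE_lebesgue_nonzero
      by eventually_elim (simp add: \<eta>_def power_mult_distrib)
  qed
  finally show ?thesis .
qed

end

section \<open>The value of the infimum\<close>

theorem theorem5p1:
  assumes "CARD('n::finite) \<ge> 2"
  shows "beta_star TYPE(real ^ 'n) = ereal (- (real CARD('n) - 1)) \<and>
         (eta1 :: real ^ 'n \<Rightarrow> real) \<in> admissible \<and>
         ereal (rayleigh_quotient (eta1 :: real ^ 'n \<Rightarrow> real)) = beta_star TYPE(real ^ 'n)"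
proof -
  define N where "N = real CARD('n)"
  define a where "a = bubble_scale N"
  have dim: "DIM(real ^ 'n) \<ge> 2" and N: "real DIM(real ^ 'n) = N"
    using assms by (simp_all add: N_def)
  have a: "a > 0"
    using assms by (simp add: a_def N_def bubble_scale_pos)
  have eta: "(eta1 :: real ^ 'n \<Rightarrow> real) = (\<lambda>x. norm x * decay a (real DIM(real ^ 'n)) ((norm x)\<^sup>2))"
    using eta1_eq[OF dim] unfolding a_def N by (rule ext)
  have adm: "(eta1 :: real ^ 'n \<Rightarrow> real) \<in> admissible"
    unfolding eta by (rule eta_admissible[OF a])
  have V: "potential = (\<lambda>x :: real ^ 'n. N * (N + 2) * a / (a + (norm x)\<^sup>2)\<^sup>2)"
    using potential_eq[OF dim] unfolding a_def N by (rule ext)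
  have quotient: "rayleigh_quotient (eta1 :: real ^ 'n \<Rightarrow> real) = - (N - 1)"
    using eta_energy[OF a, where 'a = "real ^ 'n"] inverse_square_integral_pos[OF adm]
    unfolding rayleigh_quotient_def V eta N by simp
  have "beta_star TYPE(real ^ 'n) = ereal (- (N - 1))"
    unfolding beta_star_def
  proof (rule antisym)
    show "(INF v \<in> (admissible :: (real ^ 'n \<Rightarrow> real) set). ereal (rayleigh_quotient v)) \<le> ereal (- (N - 1))"
      using INF_lower[OF adm, of "\<lambda>v. ereal (rayleigh_quotient v)"] unfolding quotient .
    show "ereal (- (N - 1)) \<le> (INF v \<in> (admissible :: (real ^ 'n \<Rightarrow> real) set). ereal (rayleigh_quotient v))"
      using rayleigh_quotient_lower_bound[OF _ dim] unfolding N by (intro INF_greatest) simp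
  qed
  then show ?thesis
    using adm quotient by (simp add: N_def)
qed

end
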